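(* Let $N\ge2$ and let $\mu$, $\mu'$ be two Markov measures on $\mathcal{K}_N$ associated to $(T,\lambda)$ and $(T',\lambda')$ respectively. If $T\ne T'$, then the two representations of $\mathcal{O}_N$ associated to $\mu$ and $\mu'$ are disjoint. Consequently, the two measures $\mu$ and $\mu'$ are mutually singular.
   Context: Let $\mathbb{Z}_N=\{0,1,\dots,N-1\}$. A representation of $\mathcal{O}_N$ on a Hilbert space is a family of isometries $(S_i)_{i\in\mathbb{Z}_N}$ with $S_i^*S_j=\delta_{ij}I$ and $\sum_{i}S_iS_i^*=I$. Two representations $(S_i)$ on $\mathcal{H}$ and $(S_i')$ on $\mathcal{H}'$ are disjoint if the only bounded operator $W:\mathcal{H}\to\mathcal{H}'$ intertwining them ($WS_i=S_i'W$ and $WS_i^*=S_i'^*W$ for all $i$) is $W=0$. Let $\mathcal{K}_N=\prod_1^\infty\mathbb{Z}_N$ be the compact space of infinite words (product topology), $\sigma(x_1x_2\dots)=x_2x_3\dots$ the shift, and for a finite word $I=i_1\dots i_n$ let $\mathcal{C}(I)=\{x\in\mathcal{K}_N: x_1=i_1,\dots,x_n=i_n\}$. Markov measure: given a vector $\lambda=(\lambda_0,\dots,\lambda_{N-1})$ and an $N\times N$ matrix $T$ with $\lambda_i>0$, $T_{ij}>0$ for all $i,j\in\mathbb{Z}_N$, $\lambda T=\lambda$ and $Te=e$ where $e=(1,\dots,1)^T$, the associated Markov measure $\mu$ is the unique Borel measure on $\mathcal{K}_N$ with $\mu(\mathcal{C}(I))=\lambda_{i_1}T_{i_1,i_2}\cdots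 T_{i_{n-1},i_n}$ for every $I=i_1\dots i_n$. The representation of $\mathcal{O}_N$ associated to the Markov measure $\mu$ is the one on $L^2(\mu)$ given by $S_jf=f_j\,(f\circ\sigma)$, where $f_j(x_1x_2\dots)=\delta_{j,x_1}\sqrt{\frac{\lambda_{x_2}}{\lambda_jT_{j,x_2}}}$, $j\in\mathbb{Z}_N$. *)

theory Defs
  imports "HOL-Analysis.Analysis" "HOL-Algebra.Algebraic_Closure_Type"
begin

section \<open>Hilbert spaces with an explicit carrier\<close>

text \<open>
  The spaces \<open>L\<^sup>2(\<mu>)\<close> depend on the measure, so Hilbert spaces are modelled as modules over the
  ring of complex numbers with an inner product. The fields \<open>mult\<close> and \<open>one\<close> inherited
  from the record of rings play no role.
\<close>

record 'a inner_space = "(complex, 'a) module" +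
  hinner :: "'a \<Rightarrow> 'a \<Rightarrow> complex"

definition hnorm :: "('a, 'm) inner_space_scheme \<Rightarrow> 'a \<Rightarrow> real" where
  "hnorm H x = sqrt (Re (hinner H x x))"

locale complex_hilbert_space = module "ring_of_type_algebra :: complex ring" H
  for H :: "('a, 'm) inner_space_scheme" (structure) +
  assumes hinner_commute:
      "\<lbrakk>x \<in> carrier H; y \<in> carrier H\<rbrakk> \<Longrightarrow> hinner H y x = cnj (hinner H x y)"
    and hinner_add_left:
      "\<lbrakk>x \<in> carrier H; y \<in> carrier H; z \<in> carrier H\<rbrakk> \<Longrightarrow>
         hinner H (x \<oplus>\<^bsub>H\<^esub> y) z = hinner H x z + hinner H y z"
    and hinner_smult_left:
      "\<lbrakk>x \<in> carrier H; y \<in> carrier H\<rbrakk> \<Longrightarrow> hinner H (c \<odot>\<^bsub>H\<^esub> x) y = c * hinner H x y"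
    and hinner_pos:
      "\<lbrakk>x \<in> carrier H; x \<noteq> \<zero>\<^bsub>H\<^esub>\<rbrakk> \<Longrightarrow> Re (hinner H x x) > 0"
    and hilbert_complete:
      "\<lbrakk>\<And>n. s n \<in> carrier H;
        \<forall>e>0. \<exists>n0::nat. \<forall>m\<ge>n0. \<forall>n\<ge>n0. hnorm H (s m \<ominus>\<^bsub>H\<^esub> s n) < e\<rbrakk> \<Longrightarrow>
         \<exists>x\<in>carrier H. (\<lambda>n. hnorm H (s n \<ominus>\<^bsub>H\<^esub> x)) \<longlonglongrightarrow> 0"

definition bounded_operator ::
    "('a, 'm) inner_space_scheme \<Rightarrow> ('b, 'k) inner_space_scheme \<Rightarrow> ('a \<Rightarrow> 'b) \<Rightarrow> bool" where
  "bounded_operator H K A \<longleftrightarrow>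
     A \<in> carrier H \<rightarrow> carrier K \<and>
     (\<forall>x\<in>carrier H. \<forall>y\<in>carrier H. A (x \<oplus>\<^bsub>H\<^esub> y) = A x \<oplus>\<^bsub>K\<^esub> A y) \<and>
     (\<forall>c. \<forall>x\<in>carrier H. A (c \<odot>\<^bsub>H\<^esub> x) = c \<odot>\<^bsub>K\<^esub> A x) \<and>
     (\<exists>C. \<forall>x\<in>carrier H. hnorm K (A x) \<le> C * hnorm H x)"

definition isometric_operator :: "('a, 'm) inner_space_scheme \<Rightarrow> ('a \<Rightarrow> 'a) \<Rightarrow> bool" where
  "isometric_operator H A \<longleftrightarrow>
     bounded_operator H H A \<and> (\<forall>x\<in>carrier H. hnorm H (A x) = hnorm H x)"

definition hadjoint :: "('a, 'm) inner_space_scheme \<Rightarrow> ('a \<Rightarrow> 'a) \<Rightarrow> 'a \<Rightarrow> 'a" where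
  "hadjoint H A y =
     (THE z. z \<in> carrier H \<and> (\<forall>x\<in>carrier H. hinner H (A x) y = hinner H x z))"

section \<open>Representations of the Cuntz algebra\<close>

definition cuntz_rep ::
    "nat \<Rightarrow> ('a, 'm) inner_space_scheme \<Rightarrow> (nat \<Rightarrow> 'a \<Rightarrow> 'a) \<Rightarrow> bool" where
  "cuntz_rep N H S \<longleftrightarrow>
     complex_hilbert_space H \<and>
     (\<forall>i<N. isometric_operator H (S i)) \<and>
     (\<forall>i<N. \<forall>j<N. \<forall>x\<in>carrier H. hadjoint H (S i) (S j x) = (if i = j then x else \<zero>\<^bsub>H\<^esub>)) \<and>
     (\<forall>x\<in>carrier H. (\<Oplus>\<^bsub>H\<^esub>i\<in>{..<N}. S i (hadjoint H (S i) x)) = x)"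

definition intertwines ::
    "nat \<Rightarrow> ('a, 'm) inner_space_scheme \<Rightarrow> (nat \<Rightarrow> 'a \<Rightarrow> 'a) \<Rightarrow>
     ('b, 'k) inner_space_scheme \<Rightarrow> (nat \<Rightarrow> 'b \<Rightarrow> 'b) \<Rightarrow> ('a \<Rightarrow> 'b) \<Rightarrow> bool" where
  "intertwines N H S H' S' W \<longleftrightarrow>
     (\<forall>i<N. \<forall>x\<in>carrier H. W (S i x) = S' i (W x) \<and>
                           W (hadjoint H (S i) x) = hadjoint H' (S' i) (W x))"

text \<open>
  Disjointness is a relation between representations, so being a representation is part of it.
\<close>

definition disjoint_reps ::
    "nat \<Rightarrow> ('a, 'm) inner_space_scheme \<Rightarrow> (nat \<Rightarrow> 'a \<Rightarrow> 'a) \<Rightarrow>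
     ('b, 'k) inner_space_scheme \<Rightarrow> (nat \<Rightarrow> 'b \<Rightarrow> 'b) \<Rightarrow> bool" where
  "disjoint_reps N H S H' S' \<longleftrightarrow>
     cuntz_rep N H S \<and> cuntz_rep N H' S' \<and>
     (\<forall>W. bounded_operator H H' W \<and> intertwines N H S H' S' W \<longrightarrow>
          (\<forall>x\<in>carrier H. W x = \<zero>\<^bsub>H'\<^esub>))"

section \<open>The Hilbert space of square-integrable functions\<close>

definition square_integrable_funs :: "'x measure \<Rightarrow> ('x \<Rightarrow> complex) set" where
  "square_integrable_funs M =
     {f \<in> borel_measurable M. integrable M (\<lambda>x. (cmod (f x))\<^sup>2)}"

text \<open>Vectors are classes of almost everywhere equal square-integrable functions.\<close>

definition ae_class :: "'x measure \<Rightarrow> ('x \<Rightarrow> complex) \<Rightarrow> ('x \<Rightarrow> complex) set" where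
  "ae_class M f = {g \<in> borel_measurable M. AE x in M. g x = f x}"

definition rep_fun :: "('x \<Rightarrow> complex) set \<Rightarrow> 'x \<Rightarrow> complex" where
  "rep_fun F = (SOME f. f \<in> F)"

definition L2 :: "'x measure \<Rightarrow> ('x \<Rightarrow> complex) set inner_space" where
  "L2 M =
     \<lparr>carrier = ae_class M ` square_integrable_funs M,
      mult = undefined,
      one = undefined,
      zero = ae_class M (\<lambda>x. 0),
      add = (\<lambda>F G. ae_class M (\<lambda>x. rep_fun F x + rep_fun G x)),
      smult = (\<lambda>c F. ae_class M (\<lambda>x. c * rep_fun F x)),
      hinner = (\<lambda>F G. integral\<^sup>L M (\<lambda>x. rep_fun F x * cnj (rep_fun G x)))\<rparr>"

section \<open>Markov measures and their representations\<close>

text \<open>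
  Letters are counted from \<open>0\<close>: the first letter of a word \<open>x\<close> is \<open>x 0\<close>.
  Below, \<open>borel\<close> on \<open>nat \<Rightarrow> nat\<close> refers to the product of the discrete topologies.
\<close>

definition words :: "nat \<Rightarrow> (nat \<Rightarrow> nat) set" where
  "words N = {x. \<forall>k. x k < N}"

definition shift :: "(nat \<Rightarrow> nat) \<Rightarrow> nat \<Rightarrow> nat" where
  "shift x = (\<lambda>k. x (Suc k))"

definition cylinder :: "nat \<Rightarrow> nat list \<Rightarrow> (nat \<Rightarrow> nat) set" where
  "cylinder N I = {x \<in> words N. \<forall>k<length I. x k = I ! k}"

definition markov_data :: "nat \<Rightarrow> (nat \<Rightarrow> nat \<Rightarrow> real) \<Rightarrow> (nat \<Rightarrow> real) \<Rightarrow> bool" where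
  "markov_data N T l \<longleftrightarrow>
     (\<forall>i<N. l i > 0) \<and> (\<forall>i<N. \<forall>j<N. T i j > 0) \<and>
     (\<forall>j<N. (\<Sum>i<N. l i * T i j) = l j) \<and>
     (\<forall>i<N. (\<Sum>j<N. T i j) = 1)"

definition markov_measure ::
    "nat \<Rightarrow> (nat \<Rightarrow> nat \<Rightarrow> real) \<Rightarrow> (nat \<Rightarrow> real) \<Rightarrow> (nat \<Rightarrow> nat) measure \<Rightarrow> bool" where
  "markov_measure N T l M \<longleftrightarrow>
     markov_data N T l \<and>
     sets M = sets (restrict_space borel (words N)) \<and>
     (\<forall>I. I \<noteq> [] \<and> set I \<subseteq> {..<N} \<longrightarrow>
        emeasure M (cylinder N I) =
          ennreal (l (I ! 0) * (\<Prod>k<length I - 1. T (I ! k) (I ! Suc k))))"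

definition markov_weight ::
    "(nat \<Rightarrow> nat \<Rightarrow> real) \<Rightarrow> (nat \<Rightarrow> real) \<Rightarrow> nat \<Rightarrow> (nat \<Rightarrow> nat) \<Rightarrow> real" where
  "markov_weight T l j x = (if x 0 = j then sqrt (l (x 1) / (l j * T j (x 1))) else 0)"

definition markov_rep ::
    "(nat \<Rightarrow> nat \<Rightarrow> real) \<Rightarrow> (nat \<Rightarrow> real) \<Rightarrow> (nat \<Rightarrow> nat) measure \<Rightarrow>
     nat \<Rightarrow> ((nat \<Rightarrow> nat) \<Rightarrow> complex) set \<Rightarrow> ((nat \<Rightarrow> nat) \<Rightarrow> complex) set" where
  "markov_rep T l M j F =
     ae_class M (\<lambda>x. complex_of_real (markov_weight T l j x) * rep_fun F (shift x))"

definition mutually_singular :: "'x measure \<Rightarrow> 'x measure \<Rightarrow> bool" where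
  "mutually_singular M M' \<longleftrightarrow>
     (\<exists>A \<in> sets M \<inter> sets M'. emeasure M A = 0 \<and> emeasure M' (space M' - A) = 0)"

end

theory Submission
  imports Defs
begin

text \<open>
  The Hellinger affinity \<open>\<Sum>\<^sub>I \<surd>(\<mu>(C(I)) \<mu>'(C(I)))\<close> over words of length \<open>n + 1\<close> is obtained from the
  \<open>n\<close>-th power of the matrix \<open>\<surd>(T\<^sub>i\<^sub>j T'\<^sub>i\<^sub>j)\<close>. Its row sums are at most \<open>1\<close>, and one of them is smaller than \<open>1\<close>
  because \<open>T \<noteq> T'\<close>; as all entries are positive, all row sums of its square are smaller than \<open>1\<close>.
  So the affinity decays exponentially. If \<open>E\<^sub>n\<close> is the union of the cylinders of length \<open>n\<close> that are
  no likelier under \<open>\<mu>\<close> than under \<open>\<mu>'\<close>, then \<open>\<mu>(E\<^sub>n)\<close> and \<open>\<mu>'(E\<^sub>n\<^sup>c)\<close> are summable along odd \<open>n\<close>. By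
  Borel-Cantelli almost every word lies in finitely many \<open>E\<^sub>n\<close> for \<open>\<mu>\<close> and in all but finitely many for
  \<open>\<mu>'\<close>, which gives singularity. An intertwiner \<open>W\<close> commutes with multiplication by the indicator \<open>1\<^sub>n\<close>
  of \<open>E\<^sub>n\<close>, so \<open>\<parallel>1\<^sub>n W f\<parallel> \<le> \<parallel>W\<parallel> \<parallel>1\<^sub>n f\<parallel>\<close>. The right-hand side tends to \<open>0\<close> and the left-hand side to
  \<open>\<parallel>W f\<parallel>\<close>.
\<close>

section \<open>Square-integrable functions form a Hilbert space\<close>

lemma ae_class_eqI: "AE x in M. f x = g x \<Longrightarrow> ae_class M f = ae_class M g"
  unfolding ae_class_def by (auto elim!: eventually_elim2)

text \<open>A measurable \<open>f\<close> belongs to its own class, so the choice in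
  \<open>rep_fun\<close> falls on a genuine member and differs from \<open>f\<close> only on a null
  set.\<close>

lemma
  assumes "f \<in> borel_measurable M"
  shows rep_fun_measurable: "rep_fun (ae_class M f) \<in> borel_measurable M"
    and rep_fun_AE: "AE x in M. rep_fun (ae_class M f) x = f x"
proof -
  have "f \<in> ae_class M f" using assms by (simp add: ae_class_def)
  then have "rep_fun (ae_class M f) \<in> ae_class M f"
    unfolding rep_fun_def by (rule someI[of "\<lambda>h. h \<in> ae_class M f"])
  then show "rep_fun (ae_class M f) \<in> borel_measurable M"
    and "AE x in M. rep_fun (ae_class M f) x = f x"
    by (auto simp: ae_class_def)
qed

lemma square_integrable_measurable [measurable_dest]:
  "f \<in> square_integrable_funs M \<Longrightarrow> f \<in> borel_measurable M"
  by (simp add: square_integrable_funs_def)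

lemma square_integrable_cmod:
  "f \<in> square_integrable_funs M \<Longrightarrow> integrable M (\<lambda>x. (cmod (f x))\<^sup>2)"
  by (simp add: square_integrable_funs_def)

lemma square_integrable_bound:
  assumes f: "f \<in> square_integrable_funs M" and [measurable]: "g \<in> borel_measurable M"
    and le: "\<And>x. cmod (g x) \<le> c * cmod (f x)"
  shows "g \<in> square_integrable_funs M"
proof -
  have "integrable M (\<lambda>x. (cmod (g x))\<^sup>2)"
  proof (rule Bochner_Integration.integrable_bound)
    show "integrable M (\<lambda>x. c\<^sup>2 * (cmod (f x))\<^sup>2)"
      using square_integrable_cmod[OF f] by simp
    show "AE x in M. norm ((cmod (g x))\<^sup>2) \<le> norm (c\<^sup>2 * (cmod (f x))\<^sup>2)"
    proof (rule AE_I2)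
      fix x
      have "(cmod (g x))\<^sup>2 \<le> (c * cmod (f x))\<^sup>2"
        using le by (intro power_mono) auto
      then show "norm ((cmod (g x))\<^sup>2) \<le> norm (c\<^sup>2 * (cmod (f x))\<^sup>2)"
        by (simp add: power_mult_distrib)
    qed
  qed simp
  then show ?thesis by (simp add: square_integrable_funs_def)
qed

lemma square_integrable_zero [simp]: "(\<lambda>x. 0) \<in> square_integrable_funs M"
  by (simp add: square_integrable_funs_def)

lemma square_integrable_cmult [intro]:
  "f \<in> square_integrable_funs M \<Longrightarrow> (\<lambda>x. c * f x) \<in> square_integrable_funs M"
  by (rule square_integrable_bound[where c="cmod c"]) (auto simp: norm_mult)

lemma square_integrable_uminus [intro]:
  "f \<in> square_integrable_funs M \<Longrightarrow> (\<lambda>x. - f x) \<in> square_integrable_funs M"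
  by (rule square_integrable_bound[where c=1]) auto

lemma cmod_add_squared_le: "(cmod (a + b))\<^sup>2 \<le> 2 * (cmod a)\<^sup>2 + 2 * (cmod b)\<^sup>2"
proof -
  have "(cmod (a + b))\<^sup>2 \<le> (cmod a + cmod b)\<^sup>2"
    by (intro power_mono norm_triangle_ineq) auto
  also have "\<dots> \<le> 2 * (cmod a)\<^sup>2 + 2 * (cmod b)\<^sup>2"
    using sum_squares_bound[of "cmod a" "cmod b"] by (simp add: power2_sum)
  finally show ?thesis .
qed

lemma square_integrable_add [intro]:
  assumes f: "f \<in> square_integrable_funs M" and g: "g \<in> square_integrable_funs M"
  shows "(\<lambda>x. f x + g x) \<in> square_integrable_funs M"
proof -
  note [measurable] = f[THEN square_integrable_measurable] g[THEN square_integrable_measurable]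
  have "integrable M (\<lambda>x. (cmod (f x + g x))\<^sup>2)"
  proof (rule Bochner_Integration.integrable_bound)
    show "integrable M (\<lambda>x. 2 * (cmod (f x))\<^sup>2 + 2 * (cmod (g x))\<^sup>2)"
      using f g by (auto simp: square_integrable_cmod)
  qed (auto intro!: AE_I2 cmod_add_squared_le)
  then show ?thesis by (simp add: square_integrable_funs_def)
qed

lemma square_integrable_diff [intro]:
  "f \<in> square_integrable_funs M \<Longrightarrow> g \<in> square_integrable_funs M \<Longrightarrow>
     (\<lambda>x. f x - g x) \<in> square_integrable_funs M"
  using square_integrable_add[OF _ square_integrable_uminus, of f M g] by simp

lemma cnj_measurable [measurable]: "cnj \<in> borel_measurable borel"
  by (intro borel_measurable_continuous_onI continuous_intros)

text \<open>The inequality \<open>2ab <= a^2 + b^2\<close> dominates the product by the sum of the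
  squared moduli.\<close>

lemma square_integrable_mult_cnj:
  assumes f: "f \<in> square_integrable_funs M" and g: "g \<in> square_integrable_funs M"
  shows "integrable M (\<lambda>x. f x * cnj (g x))"
proof -
  note [measurable] = f[THEN square_integrable_measurable] g[THEN square_integrable_measurable]
  show ?thesis
  proof (rule Bochner_Integration.integrable_bound)
    show "integrable M (\<lambda>x. (cmod (f x))\<^sup>2 + (cmod (g x))\<^sup>2)"
      using f g by (auto simp: square_integrable_cmod)
    show "AE x in M. norm (f x * cnj (g x)) \<le> norm ((cmod (f x))\<^sup>2 + (cmod (g x))\<^sup>2)"
    proof (rule AE_I2)
      fix x
      have "0 \<le> cmod (f x) * cmod (g x)" by simp
      then show "norm (f x * cnj (g x)) \<le> norm ((cmod (f x))\<^sup>2 + (cmod (g x))\<^sup>2)"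
        using sum_squares_bound[of "cmod (f x)" "cmod (g x)"]
        unfolding norm_mult complex_mod_cnj real_norm_def
        by (subst abs_of_nonneg) (simp, linarith)
    qed
  qed simp
qed

section \<open>The operations of \<open>L2\<close> computed on representatives\<close>

lemma L2_carrierI [intro]: "f \<in> square_integrable_funs M \<Longrightarrow> ae_class M f \<in> carrier (L2 M)"
  by (simp add: L2_def)

lemma L2_carrierE:
  assumes "F \<in> carrier (L2 M)"
  obtains f where "f \<in> square_integrable_funs M" "F = ae_class M f"
  using assms by (auto simp: L2_def)

lemma L2_zero: "\<zero>\<^bsub>L2 M\<^esub> = ae_class M (\<lambda>x. 0)"
  by (simp add: L2_def)

lemma L2_add:
  assumes "f \<in> square_integrable_funs M" "g \<in> square_integrable_funs M"
  shows "ae_class M f \<oplus>\<^bsub>L2 M\<^esub> ae_class M g = ae_class M (\<lambda>x. f x + g x)"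
proof -
  have "AE x in M. rep_fun (ae_class M f) x + rep_fun (ae_class M g) x = f x + g x"
    using rep_fun_AE[of f M] rep_fun_AE[of g M] assms
    by (auto simp: square_integrable_measurable elim!: eventually_elim2)
  then show ?thesis by (auto simp: L2_def intro!: ae_class_eqI)
qed

lemma L2_smult:
  assumes "f \<in> square_integrable_funs M"
  shows "c \<odot>\<^bsub>L2 M\<^esub> ae_class M f = ae_class M (\<lambda>x. c * f x)"
proof -
  have "AE x in M. c * rep_fun (ae_class M f) x = c * f x"
    using rep_fun_AE[of f M] assms
    by (auto simp: square_integrable_measurable elim!: eventually_mono)
  then show ?thesis by (auto simp: L2_def intro!: ae_class_eqI)
qed

lemma L2_inner:
  assumes f: "f \<in> square_integrable_funs M" and g: "g \<in> square_integrable_funs M"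
  shows "hinner (L2 M) (ae_class M f) (ae_class M g) = (\<integral>x. f x * cnj (g x) \<partial>M)"
proof -
  note [measurable] = f[THEN square_integrable_measurable] g[THEN square_integrable_measurable]
    rep_fun_measurable[OF f[THEN square_integrable_measurable]]
    rep_fun_measurable[OF g[THEN square_integrable_measurable]]
  have "AE x in M. rep_fun (ae_class M f) x * cnj (rep_fun (ae_class M g) x) = f x * cnj (g x)"
    using rep_fun_AE[of f M] rep_fun_AE[of g M] by (auto elim!: eventually_elim2)
  then have "(\<integral>x. rep_fun (ae_class M f) x * cnj (rep_fun (ae_class M g) x) \<partial>M)
      = (\<integral>x. f x * cnj (g x) \<partial>M)"
    by (intro integral_cong_AE) auto
  then show ?thesis by (simp add: L2_def)
qed

lemma L2_inner_self:
  assumes "f \<in> square_integrable_funs M"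
  shows "Re (hinner (L2 M) (ae_class M f) (ae_class M f)) = (\<integral>x. (cmod (f x))\<^sup>2 \<partial>M)"
proof -
  have "hinner (L2 M) (ae_class M f) (ae_class M f)
      = (\<integral>x. complex_of_real ((cmod (f x))\<^sup>2) \<partial>M)"
    unfolding L2_inner[OF assms assms] complex_norm_square ..
  then show ?thesis by (simp only: integral_complex_of_real Re_complex_of_real)
qed

lemma L2_norm:
  "f \<in> square_integrable_funs M \<Longrightarrow>
     hnorm (L2 M) (ae_class M f) = sqrt (\<integral>x. (cmod (f x))\<^sup>2 \<partial>M)"
  by (simp add: hnorm_def L2_inner_self)

lemma L2_abelian_group: "abelian_group (L2 M)"
proof (rule abelian_groupI)
  fix F assume "F \<in> carrier (L2 M)"
  then obtain f where f: "f \<in> square_integrable_funs M" and F: "F = ae_class M f"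
    by (rule L2_carrierE)
  show "\<zero>\<^bsub>L2 M\<^esub> \<oplus>\<^bsub>L2 M\<^esub> F = F"
    using f by (simp add: F L2_zero L2_add)
  show "\<exists>G\<in>carrier (L2 M). G \<oplus>\<^bsub>L2 M\<^esub> F = \<zero>\<^bsub>L2 M\<^esub>"
    using f by (intro bexI[of _ "ae_class M (\<lambda>x. - f x)"])
      (auto simp: F L2_zero L2_add[OF square_integrable_uminus])
  fix G assume "G \<in> carrier (L2 M)"
  then obtain g where g: "g \<in> square_integrable_funs M" and G: "G = ae_class M g"
    by (rule L2_carrierE)
  show "F \<oplus>\<^bsub>L2 M\<^esub> G \<in> carrier (L2 M)" using f g by (auto simp: F G L2_add)
  show "F \<oplus>\<^bsub>L2 M\<^esub> G = G \<oplus>\<^bsub>L2 M\<^esub> F" using f g by (auto simp: F G L2_add add.commute)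
  fix K assume "K \<in> carrier (L2 M)"
  then obtain k where k: "k \<in> square_integrable_funs M" and K: "K = ae_class M k"
    by (rule L2_carrierE)
  show "(F \<oplus>\<^bsub>L2 M\<^esub> G) \<oplus>\<^bsub>L2 M\<^esub> K = F \<oplus>\<^bsub>L2 M\<^esub> (G \<oplus>\<^bsub>L2 M\<^esub> K)"
    using f g k
    by (simp add: F G K L2_add L2_add[OF square_integrable_add] L2_add[OF _ square_integrable_add]
        add.assoc)
qed (auto simp: L2_zero)

text \<open>The second conjunct keeps the induction going: adding one more class through
  \<open>L2_add\<close> requires the partial sum to be square integrable.\<close>

lemma L2_finsum:
  assumes "finite A" "\<And>i. i \<in> A \<Longrightarrow> f i \<in> square_integrable_funs M"
  shows "(\<Oplus>\<^bsub>L2 M\<^esub>i\<in>A. ae_class M (f i)) = ae_class M (\<lambda>x. \<Sum>i\<in>A. f i x)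
    \<and> (\<lambda>x. \<Sum>i\<in>A. f i x) \<in> square_integrable_funs M"
  using assms
proof (induction A)
  case empty
  interpret abelian_group "L2 M" by (rule L2_abelian_group)
  show ?case by (simp add: L2_zero)
next
  case (insert a A)
  interpret abelian_group "L2 M" by (rule L2_abelian_group)
  have "(\<Oplus>\<^bsub>L2 M\<^esub>i\<in>insert a A. ae_class M (f i))
      = ae_class M (f a) \<oplus>\<^bsub>L2 M\<^esub> (\<Oplus>\<^bsub>L2 M\<^esub>i\<in>A. ae_class M (f i))"
    using insert by (intro finsum_insert) auto
  with insert show ?case by (auto simp: L2_add)
qed

lemma L2_minus:
  assumes f: "f \<in> square_integrable_funs M" and g: "g \<in> square_integrable_funs M"
  shows "ae_class M f \<ominus>\<^bsub>L2 M\<^esub> ae_class M g = ae_class M (\<lambda>x. f x - g x)"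
proof -
  interpret abelian_group "L2 M" by (rule L2_abelian_group)
  have "\<ominus>\<^bsub>L2 M\<^esub> ae_class M g = ae_class M (\<lambda>x. - g x)"
    using g by (intro minus_equality)
      (auto simp: L2_add[OF square_integrable_uminus] L2_zero)
  then show ?thesis
    using f g by (simp add: a_minus_def L2_add[OF _ square_integrable_uminus])
qed

lemma L2_module: "module (ring_of_type_algebra :: complex ring) (L2 M)"
proof (rule moduleI)
  show "cring (ring_of_type_algebra :: complex ring)" ..
  show "abelian_group (L2 M)" by (rule L2_abelian_group)
qed (auto elim!: L2_carrierE intro!: L2_carrierI square_integrable_cmult
       simp: L2_smult L2_add L2_smult[OF square_integrable_cmult]
       L2_smult[OF square_integrable_add] L2_add[OF square_integrable_cmult square_integrable_cmult]
       ring_of_type_algebra_def algebra_simps)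

text \<open>Along a subsequence with squared increments below \<open>8\<^sup>-\<^sup>k\<close>, the series of \<open>2\<^sup>k\<close> times the
  squared increments has finite integral, so the increments are summable almost everywhere.
  Fatou's lemma then identifies the pointwise limit as the limit in norm.\<close>

lemma square_integrable_complete:
  fixes f :: "nat \<Rightarrow> 'a \<Rightarrow> complex"
  assumes f: "\<And>n. f n \<in> square_integrable_funs M"
    and cauchy: "\<And>e. e > 0 \<Longrightarrow>
      \<exists>n0. \<forall>m\<ge>n0. \<forall>n\<ge>n0. (\<integral>x. (cmod (f m x - f n x))\<^sup>2 \<partial>M) < e"
  obtains g where "g \<in> square_integrable_funs M"
    "(\<lambda>n. \<integral>x. (cmod (f n x - g x))\<^sup>2 \<partial>M) \<longlonglongrightarrow> 0"
proof -
  note [measurable] = f[THEN square_integrable_measurable]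
  have nn: "(\<integral>\<^sup>+x. (cmod (f m x - f n x))\<^sup>2 \<partial>M) = ennreal (\<integral>x. (cmod (f m x - f n x))\<^sup>2 \<partial>M)" for m n
    using f by (intro nn_integral_eq_integral square_integrable_cmod) auto
  have "\<exists>n0. \<forall>m\<ge>n0. \<forall>n\<ge>n0. (\<integral>x. (cmod (f m x - f n x))\<^sup>2 \<partial>M) < (1/8)^k" for k
    by (rule cauchy) simp
  then obtain p where p: "\<And>k m n. m \<ge> p k \<Longrightarrow> n \<ge> p k \<Longrightarrow>
      (\<integral>x. (cmod (f m x - f n x))\<^sup>2 \<partial>M) < (1/8)^k"
    by metis
  \<comment> \<open>The sum dominates \<open>p k\<close> at both \<open>k\<close> and
    \<open>Suc k\<close> although \<open>p\<close> may fail to be monotone; the summand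
    \<open>k\<close> sends \<open>r\<close> to infinity.\<close>
  define r where "r k = (\<Sum>i\<le>k. p i) + k" for k
  have r_ge: "r k \<ge> p k" "r (Suc k) \<ge> p k" "r k \<ge> k" for k
    unfolding r_def
    by (auto intro!: order_trans[OF member_le_sum[of k "{..k}" p]] trans_le_add1)
  define d where "d k x = f (r (Suc k)) x - f (r k) x" for k x
  have [measurable]: "d k \<in> borel_measurable M" for k unfolding d_def by measurable
  have "(\<integral>\<^sup>+x. (\<Sum>k. ennreal (2^k * (cmod (d k x))\<^sup>2)) \<partial>M)
      = (\<Sum>k. \<integral>\<^sup>+x. ennreal (2^k * (cmod (d k x))\<^sup>2) \<partial>M)"
    by (rule nn_integral_suminf) simp
  \<comment> \<open>The weight \<open>2^k\<close> against the bound \<open>8^-k\<close> leaves the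
    geometric series of \<open>4^-k\<close>.\<close>
  also have "\<dots> \<le> (\<Sum>k. ennreal ((1/4)^k))"
  proof (intro suminf_le summableI)
    fix k
    have "(\<integral>\<^sup>+x. ennreal (2^k * (cmod (d k x))\<^sup>2) \<partial>M)
        = ennreal (2^k) * (\<integral>\<^sup>+x. (cmod (d k x))\<^sup>2 \<partial>M)"
      by (simp add: ennreal_mult nn_integral_cmult)
    also have "\<dots> \<le> ennreal (2^k) * ennreal ((1/8)^k)"
      unfolding d_def nn using p[OF r_ge(2) r_ge(1)]
      by (intro mult_left_mono ennreal_leI) (auto intro: less_imp_le)
    also have "\<dots> = ennreal ((1/4)^k)"
      by (simp flip: ennreal_mult power_mult_distrib)
    finally show "(\<integral>\<^sup>+x. ennreal (2^k * (cmod (d k x))\<^sup>2) \<partial>M) \<le> ennreal ((1/4)^k)" .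
  qed
  also have "\<dots> < \<infinity>"
    using summable_geometric[of "1/4::real"] by (simp add: suminf_ennreal2 less_top[symmetric])
  finally have "AE x in M. (\<Sum>k. ennreal (2^k * (cmod (d k x))\<^sup>2)) \<noteq> \<infinity>"
    by (intro nn_integral_PInf_AE) auto
  then have conv: "AE x in M. convergent (\<lambda>k. f (r k) x)"
  proof eventually_elim
    case (elim x)
    have "summable (\<lambda>k. 2^k * (cmod (d k x))\<^sup>2)"
      using elim by (intro summable_suminf_not_top) auto
    \<comment> \<open>The weight \<open>2^k\<close> pays off here: bounded terms
      \<open>2^k |d_k|^2 <= K\<close> give the geometric bound
      \<open>|d_k| <= sqrt K * (1 / sqrt 2)^k\<close>.\<close>
    then have "Bseq (\<lambda>k. 2^k * (cmod (d k x))\<^sup>2)"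
      by (intro convergent_imp_Bseq) (auto simp: convergent_def dest: summable_LIMSEQ_zero)
    then obtain K where K: "K > 0" "\<And>k. norm (2^k * (cmod (d k x))\<^sup>2) \<le> K"
      unfolding Bseq_def by blast
    have "summable (\<lambda>k. d k x)"
    proof (rule summable_comparison_test')
      show "summable (\<lambda>k. sqrt K * (1 / sqrt 2)^k)"
        by (intro summable_mult summable_geometric) simp
      fix k
      have "(cmod (d k x))\<^sup>2 \<le> K * (1/2)^k"
        using K(2)[of k] by (simp add: field_simps power_divide)
      then have "sqrt ((cmod (d k x))\<^sup>2) \<le> sqrt (K * (1/2)^k)"
        by (rule real_sqrt_le_mono)
      then show "norm (d k x) \<le> sqrt K * (1 / sqrt 2)^k"
        by (simp add: real_sqrt_mult real_sqrt_power real_sqrt_divide)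
    qed
    then have "convergent (\<lambda>n. \<Sum>k<n. d k x)" by (simp add: summable_iff_convergent)
    also have "(\<lambda>n. \<Sum>k<n. d k x) = (\<lambda>n. f (r n) x - f (r 0) x)"
      unfolding d_def by (auto simp: sum_lessThan_telescope[of "\<lambda>k. f (r k) x"])
    finally have "convergent (\<lambda>n. (f (r n) x - f (r 0) x) + f (r 0) x)"
      by (intro convergent_add convergent_const)
    then show ?case by simp
  qed
  \<comment> \<open>On the null set of divergence \<open>lim\<close> is one fixed unspecified
    value.\<close>
  define g where "g x = lim (\<lambda>k. f (r k) x)" for x
  have g_meas [measurable]: "g \<in> borel_measurable M"
    unfolding g_def by measurable
  have bound: "(\<integral>\<^sup>+x. (cmod (f m x - g x))\<^sup>2 \<partial>M) \<le> ennreal e"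
    if e: "\<And>n. n \<ge> m \<Longrightarrow> (\<integral>x. (cmod (f m x - f n x))\<^sup>2 \<partial>M) \<le> e" for m e
  proof -
    have "(\<integral>\<^sup>+x. (cmod (f m x - g x))\<^sup>2 \<partial>M)
        = (\<integral>\<^sup>+x. liminf (\<lambda>k. ennreal ((cmod (f m x - f (r k) x))\<^sup>2)) \<partial>M)"
    proof (rule nn_integral_cong_AE, use conv in eventually_elim)
      case (elim x)
      then have "(\<lambda>k. f (r k) x) \<longlonglongrightarrow> g x" by (simp add: g_def convergent_LIMSEQ_iff)
      then have "(\<lambda>k. ennreal ((cmod (f m x - f (r k) x))\<^sup>2)) \<longlonglongrightarrow> ennreal ((cmod (f m x - g x))\<^sup>2)"
        by (intro tendsto_intros)
      from lim_imp_Liminf[OF sequentially_bot this] show ?case by simp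
    qed
    also have "\<dots> \<le> liminf (\<lambda>k. \<integral>\<^sup>+x. ennreal ((cmod (f m x - f (r k) x))\<^sup>2) \<partial>M)"
      by (rule nn_integral_liminf) simp
    also have "\<dots> \<le> liminf (\<lambda>k. ennreal e)"
    proof (rule Liminf_mono)
      show "\<forall>\<^sub>F k in sequentially. (\<integral>\<^sup>+x. ennreal ((cmod (f m x - f (r k) x))\<^sup>2) \<partial>M) \<le> ennreal e"
        using eventually_ge_at_top[of m]
      proof eventually_elim
        case (elim k)
        then have "r k \<ge> m" using r_ge(3)[of k] by linarith
        then show ?case unfolding nn using e by (intro ennreal_leI)
      qed
    qed
    also have "\<dots> = ennreal e" by (simp add: Liminf_const)
    finally show ?thesis .
  qed
  have sq: "(\<lambda>x. f m x - g x) \<in> square_integrable_funs M \<and> (\<integral>x. (cmod (f m x - g x))\<^sup>2 \<partial>M) \<le> e"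
    if "e \<ge> 0" "\<And>n. n \<ge> m \<Longrightarrow> (\<integral>x. (cmod (f m x - f n x))\<^sup>2 \<partial>M) \<le> e" for m e
  proof -
    have le: "(\<integral>\<^sup>+x. (cmod (f m x - g x))\<^sup>2 \<partial>M) \<le> ennreal e" using that(2) by (rule bound)
    also have "ennreal e < \<infinity>" by simp
    finally have int: "integrable M (\<lambda>x. (cmod (f m x - g x))\<^sup>2)"
      by (intro integrableI_nonneg) auto
    moreover have "ennreal (\<integral>x. (cmod (f m x - g x))\<^sup>2 \<partial>M) \<le> ennreal e"
      using le nn_integral_eq_integral[OF int] by simp
    ultimately show ?thesis using \<open>e \<ge> 0\<close> by (simp add: square_integrable_funs_def)
  qed
  \<comment> \<open>One index at finite distance from \<open>g\<close> suffices, because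
    \<open>g\<close> is \<open>f (p 0)\<close> minus their difference.\<close>
  have "(\<lambda>x. f (p 0) x - g x) \<in> square_integrable_funs M"
    using sq[of 1 "p 0"] p[of 0] by (auto intro: less_imp_le)
  from square_integrable_diff[OF f[of "p 0"] this]
  have "g \<in> square_integrable_funs M" by simp
  moreover have "(\<lambda>n. \<integral>x. (cmod (f n x - g x))\<^sup>2 \<partial>M) \<longlonglongrightarrow> 0"
  proof (rule LIMSEQ_I)
    fix e :: real assume "e > 0"
    then obtain n0 where n0: "\<forall>m\<ge>n0. \<forall>n\<ge>n0. (\<integral>x. (cmod (f m x - f n x))\<^sup>2 \<partial>M) < e / 2"
      using cauchy[of "e/2"] by auto
    have "norm ((\<integral>x. (cmod (f n x - g x))\<^sup>2 \<partial>M) - 0) < e" if "n \<ge> n0" for n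
      using sq[of "e/2" n] n0 that \<open>e > 0\<close> by (force simp: less_imp_le)
    then show "\<exists>no. \<forall>n\<ge>no. norm ((\<integral>x. (cmod (f n x - g x))\<^sup>2 \<partial>M) - 0) < e" by blast
  qed
  ultimately show ?thesis by (rule that)
qed

lemma L2_hilbert: "complex_hilbert_space (L2 M)"
proof -
  interpret module "ring_of_type_algebra :: complex ring" "L2 M" by (rule L2_module)
  show ?thesis
  proof
    fix F G assume "F \<in> carrier (L2 M)" "G \<in> carrier (L2 M)"
    then obtain f g where f: "f \<in> square_integrable_funs M" and F: "F = ae_class M f"
      and g: "g \<in> square_integrable_funs M" and G: "G = ae_class M g"
      by (auto elim!: L2_carrierE)
    show "hinner (L2 M) G F = cnj (hinner (L2 M) F G)"
      using f g integral_bounded_linear[OF bounded_linear_cnj square_integrable_mult_cnj[OF f g]]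
      by (simp add: F G L2_inner mult.commute)
    show "hinner (L2 M) (c \<odot>\<^bsub>L2 M\<^esub> F) G = c * hinner (L2 M) F G" for c
      using f g by (simp add: F G L2_inner L2_smult L2_inner[OF square_integrable_cmult] mult.assoc)
    fix K assume "K \<in> carrier (L2 M)"
    then obtain k where k: "k \<in> square_integrable_funs M" and K: "K = ae_class M k"
      by (rule L2_carrierE)
    show "hinner (L2 M) (F \<oplus>\<^bsub>L2 M\<^esub> G) K = hinner (L2 M) F K + hinner (L2 M) G K"
      using f g k by (simp add: F G K L2_inner L2_add L2_inner[OF square_integrable_add]
          distrib_right square_integrable_mult_cnj)
  next
    fix F assume F0: "F \<in> carrier (L2 M)" "F \<noteq> \<zero>\<^bsub>L2 M\<^esub>"
    then obtain f where f: "f \<in> square_integrable_funs M" and F: "F = ae_class M f"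
      by (auto elim!: L2_carrierE)
    have "\<not> (AE x in M. (cmod (f x))\<^sup>2 = 0)"
      using F0(2) ae_class_eqI[of f "\<lambda>x. 0" M] by (auto simp: F L2_zero)
    then have "(\<integral>x. (cmod (f x))\<^sup>2 \<partial>M) \<noteq> 0"
      using integral_nonneg_eq_0_iff_AE[OF square_integrable_cmod[OF f]] by auto
    then show "Re (hinner (L2 M) F F) > 0"
      unfolding F L2_inner_self[OF f] by (simp add: order_less_le)
  next
    fix s :: "nat \<Rightarrow> _"
    assume s: "\<And>n. s n \<in> carrier (L2 M)"
      and cauchy: "\<forall>e>0. \<exists>n0. \<forall>m\<ge>n0. \<forall>n\<ge>n0. hnorm (L2 M) (s m \<ominus>\<^bsub>L2 M\<^esub> s n) < e"
    have "\<forall>n. \<exists>f. f \<in> square_integrable_funs M \<and> s n = ae_class M f"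
      using s by (meson L2_carrierE)
    then obtain f where f: "\<And>n. f n \<in> square_integrable_funs M" and sf: "\<And>n. s n = ae_class M (f n)"
      by metis
    have norm: "hnorm (L2 M) (s m \<ominus>\<^bsub>L2 M\<^esub> ae_class M g) = sqrt (\<integral>x. (cmod (f m x - g x))\<^sup>2 \<partial>M)"
      if "g \<in> square_integrable_funs M" for m g
      using f that by (simp add: sf L2_minus L2_norm[OF square_integrable_diff])
    have "\<exists>n0. \<forall>m\<ge>n0. \<forall>n\<ge>n0. (\<integral>x. (cmod (f m x - f n x))\<^sup>2 \<partial>M) < e" if "e > 0" for e
    proof -
      \<comment> \<open>The norm is the square root of the integral, hence the threshold
        \<open>sqrt e\<close>.\<close>
      obtain n0 where n0: "\<forall>m\<ge>n0. \<forall>n\<ge>n0. hnorm (L2 M) (s m \<ominus>\<^bsub>L2 M\<^esub> s n) < sqrt e"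
        using cauchy[rule_format, of "sqrt e"] \<open>e > 0\<close> by auto
      have "(\<integral>x. (cmod (f m x - f n x))\<^sup>2 \<partial>M) < e" if "m \<ge> n0" "n \<ge> n0" for m n
        using n0[rule_format, OF that] norm[OF f, of m n] sf[of n] by simp
      then show ?thesis by blast
    qed
    then obtain g where g: "g \<in> square_integrable_funs M"
      and lim: "(\<lambda>n. \<integral>x. (cmod (f n x - g x))\<^sup>2 \<partial>M) \<longlonglongrightarrow> 0"
      by (rule square_integrable_complete[OF f])
    have "(\<lambda>n. hnorm (L2 M) (s n \<ominus>\<^bsub>L2 M\<^esub> ae_class M g)) \<longlonglongrightarrow> 0"
      unfolding norm[OF g] using tendsto_real_sqrt[OF lim] by simp
    with g show "\<exists>x\<in>carrier (L2 M). (\<lambda>n. hnorm (L2 M) (s n \<ominus>\<^bsub>L2 M\<^esub> x)) \<longlonglongrightarrow> 0"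
      by blast
  qed
qed

text \<open>The inner product separates vectors, so the definite description in \<open>hadjoint\<close> is not junk as soon
  as some vector has the adjoint property.\<close>

lemma (in complex_hilbert_space) hadjoint_eqI:
  assumes z: "z \<in> carrier H"
    and adj: "\<And>x. x \<in> carrier H \<Longrightarrow> hinner H (A x) y = hinner H x z"
  shows "hadjoint H A y = z"
  unfolding hadjoint_def
proof (rule the_equality)
  fix w assume w: "w \<in> carrier H \<and> (\<forall>x\<in>carrier H. hinner H (A x) y = hinner H x w)"
  define v where "v = w \<ominus>\<^bsub>H\<^esub> z"
  have v: "v \<in> carrier H" using w z by (simp add: v_def)
  have w_eq: "w = v \<oplus>\<^bsub>H\<^esub> z" using w z by (simp add: v_def M.minus_eq M.a_assoc M.l_neg)
  \<comment> \<open>Additivity in the second argument comes from the first by conjugate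
    symmetry.\<close>
  have right: "hinner H x w = hinner H x v + hinner H x z" if "x \<in> carrier H" for x
    using hinner_commute[of w x] hinner_commute[of v x] hinner_commute[of z x]
      hinner_add_left[of v z x] that v z w w_eq by simp
  \<comment> \<open>Testing the adjoint property of \<open>w\<close> and \<open>z\<close> on their
    difference \<open>v\<close> makes \<open>v\<close> orthogonal to itself.\<close>
  have "hinner H v w = hinner H v z" using w adj v by metis
  then have "hinner H v v = 0" using right[OF v] by simp
  then have "v = \<zero>\<^bsub>H\<^esub>" using hinner_pos[OF v] by fastforce
  then show "w = z" using w_eq z by simp
qed (use assms in auto)

section \<open>Measures on the space of infinite words\<close>

definition initial :: "nat \<Rightarrow> (nat \<Rightarrow> nat) \<Rightarrow> nat list" where
  "initial n x = map x [0..<n]"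

lemma initial_0 [simp]: "initial 0 x = []"
  by (simp add: initial_def)

lemma length_initial [simp]: "length (initial n x) = n"
  by (simp add: initial_def)

lemma initial_Suc: "initial (Suc n) x = x 0 # initial n (shift x)"
  by (simp add: initial_def shift_def map_upt_Suc del: upt_Suc)

lemma take_initial: "m \<le> n \<Longrightarrow> take m (initial n x) = initial m x"
  by (simp add: initial_def take_map)

lemma initial_nth: "k < n \<Longrightarrow> initial n x ! k = x k"
  by (simp add: initial_def)

lemma set_initial: "x \<in> words N \<Longrightarrow> set (initial n x) \<subseteq> {..<N}"
  by (auto simp: initial_def words_def)

lemma cylinder_initial: "cylinder N I = {x \<in> words N. initial (length I) x = I}"
  by (auto simp: cylinder_def list_eq_iff_nth_eq initial_nth)

lemma shift_words: "x \<in> words N \<Longrightarrow> shift x \<in> words N"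
  by (simp add: words_def shift_def)

lemma case_nat_words: "j < N \<Longrightarrow> x \<in> words N \<Longrightarrow> case_nat j x \<in> words N"
  by (auto simp: words_def split: nat.split)

lemma shift_case_nat [simp]: "shift (case_nat j x) = x"
  by (simp add: shift_def)

lemma case_nat_shift: "case_nat (x 0) (shift x) = x"
  by (rule ext) (simp add: shift_def split: nat.split)

lemma space_words_measure:
  "sets M = sets (restrict_space borel (words N)) \<Longrightarrow> space M = words N"
  by (drule sets_eq_imp_space_eq) (simp add: space_restrict_space)

text \<open>Coordinate projections are continuous, and on the discrete space \<open>nat\<close>
  every set is Borel, so any function \<open>g\<close> of a letter is measurable.\<close>

lemma measurable_letter:
  assumes "sets M = sets (restrict_space borel (words N))"
  shows "(\<lambda>x. g (x k)) \<in> measurable M (count_space UNIV)"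
proof -
  have "(\<lambda>x::nat \<Rightarrow> nat. x k) \<in> measurable (restrict_space borel (words N)) borel"
    by (intro measurable_restrict_space1 measurable_product_coordinates)
  also have "\<dots> = measurable M (count_space UNIV)"
    by (rule measurable_cong_sets) (simp_all add: assms sets_borel_eq_count_space)
  finally show ?thesis by (rule measurable_compose) simp
qed

text \<open>Coordinates generate the Borel sets of a countable product of copies of
  \<open>nat\<close>, so measurability can be checked letter by letter.\<close>

lemma measurable_words_measureI:
  assumes sets: "sets M = sets (restrict_space borel (words N))"
    and into: "\<And>x. x \<in> space L \<Longrightarrow> f x \<in> words N"
    and coord: "\<And>k. (\<lambda>x. f x k) \<in> measurable L (count_space UNIV)"
  shows "f \<in> measurable L M"
proof -
  have "(\<lambda>x. f x k) \<in> borel_measurable L" for k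
    using coord[of k] measurable_cong_sets[OF refl sets_borel_eq_count_space[where 'a=nat], of L]
    by simp
  then have "f \<in> borel_measurable L"
    by (rule measurable_coordinatewise_then_product)
  then have "f \<in> measurable L (restrict_space borel (words N))"
    using into by (intro measurable_restrict_space2) auto
  also have "\<dots> = measurable L M"
    by (rule measurable_cong_sets) (simp_all add: sets)
  finally show ?thesis .
qed

lemma cylinder_sets:
  assumes "sets M = sets (restrict_space borel (words N))"
  shows "cylinder N I \<in> sets M"
proof -
  have [measurable]: "Measurable.pred M (\<lambda>x. x k = I ! k)" for k
    by (rule measurable_letter[OF assms])
  have "{x \<in> space M. \<forall>k<length I. x k = I ! k} \<in> sets M"
    by measurable
  then show ?thesis
    by (simp only: cylinder_def space_words_measure[OF assms])
qed

section \<open>Events decided by a finite prefix, and uniqueness of measures\<close>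

lemma finite_lists_of_length: "finite {I. set I \<subseteq> {..<N::nat} \<and> length I = n \<and> P I}"
  by (rule finite_subset[OF _ finite_lists_length_eq[of "{..<N}" n]]) auto

lemma initial_event_eq_UN:
  "{x \<in> words N. P (initial n x)}
     = (\<Union>I\<in>{I. set I \<subseteq> {..<N} \<and> length I = n \<and> P I}. cylinder N I)"
  by (auto simp: cylinder_initial set_initial)

lemma initial_event_sets:
  assumes "sets M = sets (restrict_space borel (words N))"
  shows "{x \<in> words N. P (initial n x)} \<in> sets M"
  unfolding initial_event_eq_UN
  by (intro sets.finite_UN finite_lists_of_length cylinder_sets[OF assms])

text \<open>Prefixes of a fixed length split the words into finitely many disjoint cylinders, so
  additivity applies.\<close>

lemma emeasure_initial_event:
  assumes "sets M = sets (restrict_space borel (words N))"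
  shows "emeasure M {x \<in> words N. P (initial n x)}
    = (\<Sum>I | set I \<subseteq> {..<N} \<and> length I = n \<and> P I. emeasure M (cylinder N I))"
  unfolding initial_event_eq_UN
proof (rule sum_emeasure[symmetric])
  show "disjoint_family_on (cylinder N) {I. set I \<subseteq> {..<N} \<and> length I = n \<and> P I}"
    by (auto simp: disjoint_family_on_def cylinder_initial)
qed (auto intro: finite_lists_of_length cylinder_sets[OF assms])

text \<open>The bound \<open>n >= 2\<close> lets equality of measures be tested on cylinders with
  two explicit leading letters. By \<open>initial_eventsI\<close> events decided by shorter prefixes
  are still included.\<close>

definition initial_events :: "nat \<Rightarrow> (nat \<Rightarrow> nat) set set" where
  "initial_events N = {{x \<in> words N. P (initial n x)} | P n. n \<ge> 2}"

lemma initial_eventsI: "{x \<in> words N. P (initial n x)} \<in> initial_events N"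
  unfolding initial_events_def
  by (rule CollectI, rule exI[of _ "\<lambda>I. P (take n I)"], rule exI[of _ "n + 2"])
    (simp add: take_initial)

lemma Int_stable_initial_events: "Int_stable (initial_events N)"
proof (rule Int_stableI)
  fix A B assume "A \<in> initial_events N" "B \<in> initial_events N"
  then obtain P n Q m where A: "A = {x \<in> words N. P (initial n x)}"
    and B: "B = {x \<in> words N. Q (initial m x)}"
    unfolding initial_events_def by blast
  \<comment> \<open>Both events are decided by the common prefix of length
    \<open>n + m\<close>.\<close>
  have "A \<inter> B = {x \<in> words N. P (take n (initial (n + m) x)) \<and> Q (take m (initial (n + m) x))}"
    by (auto simp: A B take_initial)
  then show "A \<inter> B \<in> initial_events N"
    using initial_eventsI[of N "\<lambda>I. P (take n I) \<and> Q (take m I)" "n + m"] by simp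
qed

lemma sets_words_measure:
  assumes "sets M = sets (restrict_space borel (words N))"
  shows "sets M = sigma_sets (words N) (initial_events N)"
proof
  have sub: "initial_events N \<subseteq> Pow (words N)" by (auto simp: initial_events_def)
  have ev: "initial_events N \<subseteq> sets M"
    using initial_event_sets[OF assms] by (auto simp: initial_events_def)
  show "sigma_sets (words N) (initial_events N) \<subseteq> sets M"
    using sets.sigma_sets_subset[OF ev] by (simp add: space_words_measure[OF assms])
  let ?S = "sigma (words N) (initial_events N)"
  \<comment> \<open>Measurability of the identity amounts to the inclusion of \<open>sets M\<close>
    in the generated sigma-algebra, and every coordinate event is a prefix event.\<close>
  have "(\<lambda>x. x) \<in> measurable ?S M"
  proof (rule measurable_words_measureI[OF assms])
    fix k
    show "(\<lambda>x. x k) \<in> measurable ?S (count_space UNIV)"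
    proof (rule measurableI)
      fix A :: "nat set"
      have "(\<lambda>x. x k) -` A \<inter> space ?S = {x \<in> words N. initial (Suc k) x ! k \<in> A}"
        using sub by (auto simp: initial_nth space_measure_of)
      then show "(\<lambda>x. x k) -` A \<inter> space ?S \<in> sets ?S"
        using initial_eventsI[of N "\<lambda>I. I ! k \<in> A" "Suc k"] sub by simp
    qed simp
  qed (use sub in \<open>simp add: space_measure_of\<close>)
  then show "sets M \<subseteq> sigma_sets (words N) (initial_events N)"
    using sub sets.sets_into_space[of _ M] space_words_measure[OF assms]
    by (auto simp: measurable_def Int_absorb2)
qed

text \<open>The prefix events form a generating pi-system, and each is a finite disjoint union of
  cylinders of length at least two.\<close>

lemma words_measure_eqI:
  assumes M1: "sets M1 = sets (restrict_space borel (words N))"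
    and M2: "sets M2 = sets (restrict_space borel (words N))"
    and eq: "\<And>i a I. set (i # a # I) \<subseteq> {..<N} \<Longrightarrow>
      emeasure M1 (cylinder N (i # a # I)) = emeasure M2 (cylinder N (i # a # I))"
    and fin: "emeasure M1 (words N) \<noteq> \<infinity>"
  shows "M1 = M2"
proof (rule measure_eqI_generator_eq[OF Int_stable_initial_events _ _
      sets_words_measure[OF M1] sets_words_measure[OF M2]])
  show "initial_events N \<subseteq> Pow (words N)" by (auto simp: initial_events_def)
  show "emeasure M1 A = emeasure M2 A" if A_event: "A \<in> initial_events N" for A
  proof -
    obtain P n where n: "n \<ge> 2" and A: "A = {x \<in> words N. P (initial n x)}"
      using A_event unfolding initial_events_def by blast
    have "emeasure M1 (cylinder N I) = emeasure M2 (cylinder N I)"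
      if "set I \<subseteq> {..<N}" "length I = n" for I
    proof -
      obtain i a J where "I = i # a # J"
        using n \<open>length I = n\<close> by (cases I; cases "tl I") auto
      with that eq show ?thesis by simp
    qed
    then show ?thesis
      unfolding A emeasure_initial_event[OF M1] emeasure_initial_event[OF M2]
      by (intro sum.cong) auto
  qed
  show "range (\<lambda>_::nat. words N) \<subseteq> initial_events N"
    using initial_eventsI[of N "\<lambda>_. True" 0] by auto
  show "(\<Union>_::nat. words N) = words N" by simp
  show "emeasure M1 (words N) \<noteq> \<infinity>" by (rule fin)
qed

section \<open>The representation of a Markov measure\<close>

text \<open>The conditional probability of continuing with \<open>I\<close> after the letter
  \<open>i\<close>. Recursion on the list suits inductions that peel off the first letter.\<close>

fun path_weight :: "(nat \<Rightarrow> nat \<Rightarrow> real) \<Rightarrow> nat \<Rightarrow> nat list \<Rightarrow> real" where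
  "path_weight T i [] = 1"
| "path_weight T i (a # I) = T i a * path_weight T a I"

lemma path_weight_eq_prod:
  "(\<Prod>k<length I. T ((i # I) ! k) ((i # I) ! Suc k)) = path_weight T i I"
proof (induction I arbitrary: i)
  case (Cons a I)
  show ?case using Cons[of a] by (simp add: prod.lessThan_Suc_shift del: prod.lessThan_Suc)
qed simp

text \<open>\<open>vec_isom T l j\<close> and \<open>vec_adj T l j\<close> are the isometry \<open>S\<^sub>j\<close> and its adjoint on functions
  rather than on classes. The adjoint is read off from \<open>d\<mu>(jx) / d\<mu>(x) = cons_density T l j x\<close>.\<close>

definition cons_density :: "(nat \<Rightarrow> nat \<Rightarrow> real) \<Rightarrow> (nat \<Rightarrow> real) \<Rightarrow> nat \<Rightarrow> (nat \<Rightarrow> nat) \<Rightarrow> real" where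
  "cons_density T l j x = l j * T j (x 0) / l (x 0)"

definition vec_isom ::
    "(nat \<Rightarrow> nat \<Rightarrow> real) \<Rightarrow> (nat \<Rightarrow> real) \<Rightarrow> nat \<Rightarrow> ((nat \<Rightarrow> nat) \<Rightarrow> complex) \<Rightarrow> (nat \<Rightarrow> nat) \<Rightarrow> complex" where
  "vec_isom T l j f x = complex_of_real (markov_weight T l j x) * f (shift x)"

definition vec_adj ::
    "(nat \<Rightarrow> nat \<Rightarrow> real) \<Rightarrow> (nat \<Rightarrow> real) \<Rightarrow> nat \<Rightarrow> ((nat \<Rightarrow> nat) \<Rightarrow> complex) \<Rightarrow> (nat \<Rightarrow> nat) \<Rightarrow> complex" where
  "vec_adj T l j f x = complex_of_real (sqrt (cons_density T l j x)) * f (case_nat j x)"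

locale markov =
  fixes N :: nat and T :: "nat \<Rightarrow> nat \<Rightarrow> real" and l :: "nat \<Rightarrow> real" and M :: "(nat \<Rightarrow> nat) measure"
  assumes markov: "markov_measure N T l M"
begin

lemma l_pos: "i < N \<Longrightarrow> l i > 0"
  and T_pos: "i < N \<Longrightarrow> j < N \<Longrightarrow> T i j > 0"
  and T_sum: "i < N \<Longrightarrow> (\<Sum>j<N. T i j) = 1"
  using markov by (auto simp: markov_measure_def markov_data_def)

lemma sets_M: "sets M = sets (restrict_space borel (words N))"
  using markov by (simp add: markov_measure_def)

lemma space_M: "space M = words N"
  by (rule space_words_measure[OF sets_M])

lemma emeasure_cylinder:
  assumes "set (i # I) \<subseteq> {..<N}"
  shows "emeasure M (cylinder N (i # I)) = ennreal (l i * path_weight T i I)"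
proof -
  have "emeasure M (cylinder N (i # I)) = ennreal (l i * (\<Prod>k<length I. T ((i # I) ! k) ((i # I) ! Suc k)))"
    using markov assms by (auto simp: markov_measure_def)
  then show ?thesis by (simp only: path_weight_eq_prod)
qed

lemma path_weight_nonneg: "set (i # I) \<subseteq> {..<N} \<Longrightarrow> path_weight T i I \<ge> 0"
  by (induction I arbitrary: i) (auto intro!: mult_nonneg_nonneg less_imp_le[OF T_pos])

text \<open>The total mass is the sum of the entries of \<open>l\<close>, which is not fixed to be
  \<open>1\<close>; hence a finite measure and not a probability measure.\<close>

sublocale finite_measure M
proof
  have "emeasure M {x \<in> words N. True} = (\<Sum>I | set I \<subseteq> {..<N} \<and> length I = 1. emeasure M (cylinder N I))"
    using emeasure_initial_event[OF sets_M, of "\<lambda>_. True" 1] by simp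
  also have "\<dots> \<noteq> \<infinity>"
    using finite_lists_length_eq[of "{..<N}" 1]
    by (auto simp: length_Suc_conv emeasure_cylinder)
  finally show "emeasure M (space M) \<noteq> \<infinity>" by (simp add: space_M)
qed

lemma letter_measurable [measurable]: "(\<lambda>x. g (x k)) \<in> measurable M (count_space UNIV)"
  by (rule measurable_letter[OF sets_M])

lemma letter_borel_measurable [measurable]: "(\<lambda>x. g (x k) :: 'b::topological_space) \<in> borel_measurable M"
  by (rule measurable_compose[OF letter_measurable[of "\<lambda>a. a"]]) simp

lemma shift_measurable [measurable]: "shift \<in> measurable M M"
proof (rule measurable_words_measureI[OF sets_M])
  show "(\<lambda>x. shift x k) \<in> measurable M (count_space UNIV)" for k
    unfolding shift_def by (rule letter_measurable)
qed (simp add: space_M shift_words)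

lemma case_nat_measurable:
  assumes "j < N"
  shows "case_nat j \<in> measurable M M"
proof (rule measurable_words_measureI[OF sets_M])
  show "(\<lambda>x. case_nat j x k) \<in> measurable M (count_space UNIV)" for k
    using letter_measurable[of "\<lambda>a. a"] by (cases k) auto
qed (use assms in \<open>simp add: space_M case_nat_words\<close>)

lemma cons_density_measurable [measurable]: "cons_density T l j \<in> borel_measurable M"
  unfolding cons_density_def [abs_def] by (rule letter_borel_measurable)

lemma markov_weight_measurable [measurable]: "markov_weight T l j \<in> borel_measurable M"
proof -
  have "(\<lambda>x. (if x 0 = j then 1 else 0) * sqrt (l (x 1) / (l j * T j (x 1)))) \<in> borel_measurable M"
    by (intro borel_measurable_times letter_borel_measurable)
  then show ?thesis
    by (rule measurable_cong[THEN iffD1, rotated]) (simp add: markov_weight_def)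
qed

lemma indicator_letter_measurable [measurable]:
  "(indicator {x. x 0 = j} :: _ \<Rightarrow> 'b::{topological_space, zero_neq_one}) \<in> borel_measurable M"
proof -
  have "indicator {x. x 0 = j} = (\<lambda>x. indicator {j} (x 0) :: 'b)"
    by (auto simp: indicator_def)
  then show ?thesis using letter_borel_measurable[of "indicator {j}" 0] by simp
qed

section \<open>Prepending a letter as a change of variables\<close>

lemma cons_density_pos: "j < N \<Longrightarrow> x \<in> words N \<Longrightarrow> cons_density T l j x > 0"
  by (auto simp: cons_density_def words_def intro!: divide_pos_pos mult_pos_pos l_pos T_pos)

text \<open>On words starting with \<open>j\<close> the weight is the inverse square root of the
  density of prepending \<open>j\<close>; this is what makes \<open>S_j\<close> isometric.\<close>

lemma markov_weight_eq:
  "markov_weight T l j x = (if x 0 = j then 1 / sqrt (cons_density T l j (shift x)) else 0)"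
  by (simp add: markov_weight_def cons_density_def shift_def real_sqrt_divide)

text \<open>Both measures vanish on cylinders that do not start with \<open>j\<close>. On
  \<open>j # a # I\<close> the factor \<open>l a\<close> in the measure of \<open>a # I\<close>
  cancels the denominator of the density, leaving the Markov weight of the longer word.\<close>

lemma cons_distr:
  assumes j: "j < N"
  shows "distr (density M (cons_density T l j)) M (case_nat j) = density M (indicator {x. x 0 = j})"
proof (rule words_measure_eqI)
  note [measurable] = case_nat_measurable[OF j]
  show "sets (distr (density M (cons_density T l j)) M (case_nat j)) = sets (restrict_space borel (words N))"
    "sets (density M (indicator {x. x 0 = j})) = sets (restrict_space borel (words N))"
    by (simp_all add: sets_M)
  fix i a I assume I: "set (i # a # I) \<subseteq> {..<N}"
  have [measurable]: "cylinder N J \<in> sets M" for J by (rule cylinder_sets[OF sets_M])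
  have pre: "case_nat j -` cylinder N (i # a # I) \<inter> space M
      = (if i = j then cylinder N (a # I) else {})"
    using j by (auto simp: cylinder_initial space_M initial_Suc case_nat_words)
  have "emeasure (distr (density M (cons_density T l j)) M (case_nat j)) (cylinder N (i # a # I))
      = (if i = j then \<integral>\<^sup>+x. ennreal (cons_density T l j x) * indicator (cylinder N (a # I)) x \<partial>M else 0)"
    by (simp add: emeasure_distr pre emeasure_density)
  \<comment> \<open>On this cylinder the first letter is \<open>a\<close>, so the density is
    constant; hence the second explicit letter.\<close>
  also have "\<dots> = (if i = j then \<integral>\<^sup>+x. ennreal (l j * T j a / l a) * indicator (cylinder N (a # I)) x \<partial>M else 0)"
    by (auto intro!: nn_integral_cong simp: cons_density_def cylinder_def indicator_def)
  also have "\<dots> = (if i = j then ennreal (l i * path_weight T i (a # I)) else 0)"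
    using I j l_pos[of a] l_pos[of i] T_pos[of i a] path_weight_nonneg[of a I]
    by (auto simp: nn_integral_cmult_indicator emeasure_cylinder simp flip: ennreal_mult)
  also have "\<dots> = (if i = j then emeasure M (cylinder N (i # a # I)) else 0)"
    using I by (simp add: emeasure_cylinder del: path_weight.simps)
  also have "\<dots> = (\<integral>\<^sup>+x. (if i = j then indicator (cylinder N (i # a # I)) x else 0) \<partial>M)"
    by simp
  also have "\<dots> = (\<integral>\<^sup>+x. indicator {x. x 0 = j} x * indicator (cylinder N (i # a # I)) x \<partial>M)"
    by (intro nn_integral_cong) (auto simp: indicator_def cylinder_def)
  also have "\<dots> = emeasure (density M (indicator {x. x 0 = j})) (cylinder N (i # a # I))"
    by (subst emeasure_density) auto
  finally show "emeasure (distr (density M (cons_density T l j)) M (case_nat j)) (cylinder N (i # a # I))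
    = emeasure (density M (indicator {x. x 0 = j})) (cylinder N (i # a # I))" .
next
  note [measurable] = case_nat_measurable[OF j]
  have "emeasure (distr (density M (cons_density T l j)) M (case_nat j)) (words N)
      = (\<integral>\<^sup>+x. ennreal (cons_density T l j x) \<partial>M)"
    using j by (simp add: emeasure_distr emeasure_density space_M[symmetric] vimage_def)
      (auto simp: space_M case_nat_words intro!: nn_integral_cong)
  also have "\<dots> < \<infinity>"
  proof -
    \<comment> \<open>The density takes finitely many values, and their sum bounds it.\<close>
    have "(\<integral>\<^sup>+x. ennreal (cons_density T l j x) \<partial>M)
        \<le> (\<integral>\<^sup>+x. (\<Sum>a<N. ennreal (l j * T j a / l a)) \<partial>M)"
    proof (rule nn_integral_mono)
      fix x assume "x \<in> space M"
      then have "x 0 \<in> {..<N}" by (simp add: space_M words_def)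
      then show "ennreal (cons_density T l j x) \<le> (\<Sum>a<N. ennreal (l j * T j a / l a))"
        unfolding cons_density_def
        by (rule member_le_sum[of "x 0" "{..<N}" "\<lambda>a. ennreal (l j * T j a / l a)"]) auto
    qed
    also have "\<dots> < \<infinity>"
      by (auto simp: less_top[symmetric] ennreal_mult_eq_top_iff)
    finally show ?thesis .
  qed
  finally show "emeasure (distr (density M (cons_density T l j)) M (case_nat j)) (words N) \<noteq> \<infinity>"
    by simp
qed

text \<open>On words starting with \<open>j\<close> the shift inverts prepending \<open>j\<close>,
  so \<open>cons_distr\<close> pulls null sets back to null sets, one first letter at a time. This
  makes composition with the shift well defined on classes.\<close>

lemma AE_shift:
  assumes "AE x in M. P x"
  shows "AE x in M. P (shift x)"
proof -
  obtain Z where Z: "\<And>x. x \<in> space M - Z \<Longrightarrow> P x" "Z \<in> null_sets M"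
    using assms(1) by (rule AE_E3) blast
  have Zm [measurable]: "Z \<in> sets M" using Z(2) by auto
  have "AE x in M. x 0 = j \<longrightarrow> shift x \<notin> Z" if j: "j < N" for j
  proof -
    note [measurable] = case_nat_measurable[OF j]
    \<comment> \<open>Here \<open>shift (case_nat j x)\<close> is just \<open>x\<close>.\<close>
    have "AE x in density M (cons_density T l j). shift (case_nat j x) \<notin> Z"
      using AE_not_in[OF Z(2)] by (subst AE_density) auto
    then have "AE x in density M (indicator {x. x 0 = j}). shift x \<notin> Z"
      unfolding cons_distr[OF j, symmetric] by (subst AE_distr_iff) auto
    then have "AE x in M. (0::ennreal) < indicator {x. x 0 = j} x \<longrightarrow> shift x \<notin> Z"
      by (subst (asm) AE_density) auto
    then show ?thesis by (rule AE_mp) (auto intro!: AE_I2)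
  qed
  then have "AE x in M. \<forall>j\<in>{..<N}. x 0 = j \<longrightarrow> shift x \<notin> Z"
    by (intro AE_finite_allI) auto
  then show ?thesis
  proof (rule AE_mp, intro AE_I2 impI)
    fix x assume x: "x \<in> space M" and *: "\<forall>j\<in>{..<N}. x 0 = j \<longrightarrow> shift x \<notin> Z"
    have "shift x \<notin> Z" using * x by (auto simp: space_M words_def)
    then show "P (shift x)"
      using x by (intro Z(1)) (auto simp: space_M shift_words)
  qed
qed

lemma AE_cons_density_nonneg: "j < N \<Longrightarrow> AE x in M. 0 \<le> cons_density T l j x"
  using cons_density_pos by (intro AE_I2) (auto simp: space_M less_imp_le)

text \<open>Both sides integrate \<open>h\<close> against the same measure, in its two descriptions
  from \<open>cons_distr\<close>. A general codomain serves real squared norms and complex inner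
  products alike.\<close>

lemma
  fixes h :: "(nat \<Rightarrow> nat) \<Rightarrow> 'b::{banach, second_countable_topology}"
  assumes j: "j < N" and h [measurable]: "h \<in> borel_measurable M"
  shows integrable_cons: "integrable M (\<lambda>x. indicator {x. x 0 = j} x *\<^sub>R h x)
      \<longleftrightarrow> integrable M (\<lambda>x. cons_density T l j x *\<^sub>R h (case_nat j x))"
    and integral_cons: "(\<integral>x. indicator {x. x 0 = j} x *\<^sub>R h x \<partial>M)
      = (\<integral>x. cons_density T l j x *\<^sub>R h (case_nat j x) \<partial>M)"
proof -
  note [measurable] = case_nat_measurable[OF j]
  have eq: "distr (density M (cons_density T l j)) M (case_nat j)
      = density M (\<lambda>x. ennreal (indicator {x. x 0 = j} x))"
    unfolding cons_distr[OF j] by (intro arg_cong[of _ _ "density M"] ext) (simp add: indicator_def)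
  have "integrable M (\<lambda>x. indicator {x. x 0 = j} x *\<^sub>R h x)
      \<longleftrightarrow> integrable (density M (\<lambda>x. ennreal (indicator {x. x 0 = j} x))) h"
    by (subst integrable_density) auto
  also have "\<dots> \<longleftrightarrow> integrable (density M (cons_density T l j)) (\<lambda>x. h (case_nat j x))"
    unfolding eq[symmetric] by (subst integrable_distr_eq) auto
  also have "\<dots> \<longleftrightarrow> integrable M (\<lambda>x. cons_density T l j x *\<^sub>R h (case_nat j x))"
    using AE_cons_density_nonneg[OF j] by (subst integrable_density) auto
  finally show "integrable M (\<lambda>x. indicator {x. x 0 = j} x *\<^sub>R h x)
      \<longleftrightarrow> integrable M (\<lambda>x. cons_density T l j x *\<^sub>R h (case_nat j x))" .
  have "(\<integral>x. indicator {x. x 0 = j} x *\<^sub>R h x \<partial>M)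
      = (\<integral>x. h x \<partial>density M (\<lambda>x. ennreal (indicator {x. x 0 = j} x)))"
    by (subst integral_density) auto
  also have "\<dots> = (\<integral>x. h (case_nat j x) \<partial>density M (cons_density T l j))"
    unfolding eq[symmetric] by (subst integral_distr) auto
  also have "\<dots> = (\<integral>x. cons_density T l j x *\<^sub>R h (case_nat j x) \<partial>M)"
    using AE_cons_density_nonneg[OF j] by (subst integral_density) auto
  finally show "(\<integral>x. indicator {x. x 0 = j} x *\<^sub>R h x \<partial>M)
      = (\<integral>x. cons_density T l j x *\<^sub>R h (case_nat j x) \<partial>M)" .
qed

section \<open>The isometries and their adjoints, on functions and then on classes\<close>

lemma vec_isom_measurable [measurable]:
  assumes [measurable]: "f \<in> borel_measurable M"
  shows "vec_isom T l j f \<in> borel_measurable M"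
  unfolding vec_isom_def [abs_def] by measurable

lemma vec_adj_measurable:
  assumes "j < N" and [measurable]: "f \<in> borel_measurable M"
  shows "vec_adj T l j f \<in> borel_measurable M"
proof -
  note [measurable] = case_nat_measurable[OF assms(1)]
  show ?thesis unfolding vec_adj_def [abs_def] by measurable
qed

lemma vec_isom_eq:
  "vec_isom T l j f x
     = (if x 0 = j then f (shift x) / complex_of_real (sqrt (cons_density T l j (shift x))) else 0)"
  by (simp add: vec_isom_def markov_weight_eq)

lemma vec_adj_isom:
  assumes "i < N" "x \<in> words N"
  shows "vec_adj T l i (vec_isom T l j f) x = (if i = j then f x else 0)"
  using cons_density_pos[OF assms] by (auto simp: vec_adj_def vec_isom_eq)

text \<open>With \<open>\<phi> = 1\<close> this is \<open>\<Sum>\<^sub>i S\<^sub>i S\<^sub>i\<^sup>* = I\<close>. The general form writes multiplication by a function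
  as \<open>\<Sum>\<^sub>i S\<^sub>i \<phi>\<^sub>i S\<^sub>i\<^sup>*\<close> with \<open>\<phi>\<^sub>i(x) = \<phi>(ix)\<close>.\<close>

lemma sum_isom_adj:
  assumes x: "x \<in> words N"
  shows "(\<Sum>i<N. vec_isom T l i (\<lambda>y. \<phi> i y * vec_adj T l i f y) x) = \<phi> (x 0) (shift x) * f x"
proof -
  have x0: "x 0 < N" using x by (simp add: words_def)
  \<comment> \<open>Only the summand with \<open>i = x 0\<close> survives, and there the two square
    roots cancel.\<close>
  have "(\<Sum>i<N. vec_isom T l i (\<lambda>y. \<phi> i y * vec_adj T l i f y) x)
      = (\<Sum>i<N. if i = x 0 then \<phi> (x 0) (shift x) * f x else 0)"
    using cons_density_pos[OF x0 shift_words[OF x]]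
    by (intro sum.cong) (auto simp: vec_isom_eq vec_adj_def case_nat_shift)
  then show ?thesis using x0 by (simp add: sum.delta')
qed

lemma square_integrable_mult_of_bool:
  assumes f: "f \<in> square_integrable_funs M"
  shows "(\<lambda>x. of_bool (P (initial n x)) * f x) \<in> square_integrable_funs M"
proof (rule square_integrable_bound[OF f])
  note [measurable] = f[THEN square_integrable_measurable]
  have [measurable]: "{x \<in> words N. P (initial n x)} \<in> sets M"
    by (rule initial_event_sets[OF sets_M])
  have "(\<lambda>x. indicator {x \<in> words N. P (initial n x)} x * f x) \<in> borel_measurable M"
    by measurable
  then show "(\<lambda>x. of_bool (P (initial n x)) * f x) \<in> borel_measurable M"
    by (rule measurable_cong[THEN iffD1, rotated]) (simp add: space_M indicator_def)
  show "cmod (of_bool (P (initial n x)) * f x) \<le> 1 * cmod (f x)" for x by simp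
qed

text \<open>The image of \<open>f\<close> is supported on words starting with \<open>j\<close>, so
  the indicator can be inserted freely; after the change of variables the density cancels the
  squared weight.\<close>

lemma
  assumes j: "j < N" and f: "f \<in> square_integrable_funs M"
  shows vec_isom_square_integrable: "vec_isom T l j f \<in> square_integrable_funs M"
    and vec_isom_norm: "(\<integral>x. (cmod (vec_isom T l j f x))\<^sup>2 \<partial>M) = (\<integral>x. (cmod (f x))\<^sup>2 \<partial>M)"
proof -
  note [measurable] = f[THEN square_integrable_measurable]
  have 1: "(\<lambda>x. indicator {x. x 0 = j} x *\<^sub>R (cmod (vec_isom T l j f x))\<^sup>2)
      = (\<lambda>x. (cmod (vec_isom T l j f x))\<^sup>2)"
    by (auto simp: vec_isom_eq indicator_def)
  have 2: "cons_density T l j x * (cmod (vec_isom T l j f (case_nat j x)))\<^sup>2 = (cmod (f x))\<^sup>2"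
    if "x \<in> space M" for x
    using cons_density_pos[OF j, of x] that
    by (simp add: vec_isom_eq space_M norm_divide power_divide)
  have "integrable M (\<lambda>x. (cmod (vec_isom T l j f x))\<^sup>2) \<longleftrightarrow> integrable M (\<lambda>x. (cmod (f x))\<^sup>2)"
    unfolding 1[symmetric] by (subst integrable_cons[OF j]) (auto intro!: Bochner_Integration.integrable_cong simp: 2)
  then show "vec_isom T l j f \<in> square_integrable_funs M"
    using f by (simp add: square_integrable_funs_def)
  show "(\<integral>x. (cmod (vec_isom T l j f x))\<^sup>2 \<partial>M) = (\<integral>x. (cmod (f x))\<^sup>2 \<partial>M)"
    unfolding 1[symmetric] by (subst integral_cons[OF j]) (auto intro!: Bochner_Integration.integral_cong simp: 2)
qed

text \<open>Up to the change of variables, the squared modulus is that of \<open>f\<close>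
  restricted to words starting with \<open>j\<close>.\<close>

lemma vec_adj_square_integrable:
  assumes j: "j < N" and f: "f \<in> square_integrable_funs M"
  shows "vec_adj T l j f \<in> square_integrable_funs M"
proof -
  note [measurable] = f[THEN square_integrable_measurable]
  have "integrable M (\<lambda>x. indicator {x. x 0 = j} x *\<^sub>R (cmod (f x))\<^sup>2)"
  proof (rule Bochner_Integration.integrable_bound[OF square_integrable_cmod[OF f]])
    show "(\<lambda>x. indicator {x. x 0 = j} x *\<^sub>R (cmod (f x))\<^sup>2) \<in> borel_measurable M" by measurable
  qed (auto simp: indicator_def)
  then have "integrable M (\<lambda>x. cons_density T l j x *\<^sub>R (cmod (f (case_nat j x)))\<^sup>2)"
    by (subst (asm) integrable_cons[OF j]) auto
  also have "?this \<longleftrightarrow> integrable M (\<lambda>x. (cmod (vec_adj T l j f x))\<^sup>2)"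
    using cons_density_pos[OF j]
    by (intro Bochner_Integration.integrable_cong) (auto simp: space_M vec_adj_def norm_mult power_mult_distrib less_imp_le)
  finally show ?thesis
    using vec_adj_measurable[OF j] by (simp add: square_integrable_funs_def)
qed

lemma vec_isom_inner:
  assumes j: "j < N" and f: "f \<in> square_integrable_funs M" and g: "g \<in> square_integrable_funs M"
  shows "(\<integral>x. vec_isom T l j f x * cnj (g x) \<partial>M) = (\<integral>x. f x * cnj (vec_adj T l j g x) \<partial>M)"
proof -
  note [measurable] = f[THEN square_integrable_measurable] g[THEN square_integrable_measurable]
  have 1: "(\<lambda>x. indicator {x. x 0 = j} x *\<^sub>R (vec_isom T l j f x * cnj (g x)))
      = (\<lambda>x. vec_isom T l j f x * cnj (g x))"
    by (auto simp: vec_isom_eq indicator_def)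
  have 2: "cons_density T l j x *\<^sub>R (vec_isom T l j f (case_nat j x) * cnj (g (case_nat j x)))
      = f x * cnj (vec_adj T l j g x)" if "x \<in> space M" for x
  proof -
    have pos: "cons_density T l j x > 0" using cons_density_pos[OF j] that by (simp add: space_M)
    \<comment> \<open>Of the two square roots, one cancels the weight of the isometry and the other
      becomes the factor in \<open>vec_adj\<close>.\<close>
    then have "complex_of_real (cons_density T l j x)
        = complex_of_real (sqrt (cons_density T l j x)) * complex_of_real (sqrt (cons_density T l j x))"
      by (simp flip: of_real_mult)
    with pos show ?thesis by (simp add: vec_isom_eq vec_adj_def scaleR_conv_of_real)
  qed
  show ?thesis
    unfolding 1[symmetric] by (subst integral_cons[OF j]) (auto intro!: Bochner_Integration.integral_cong simp: 2)
qed

text \<open>By \<open>AE_shift\<close> replacing the chosen representative by \<open>f\<close>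
  changes the composition with the shift only on a null set.\<close>

lemma markov_rep_class:
  assumes "f \<in> borel_measurable M"
  shows "markov_rep T l M j (ae_class M f) = ae_class M (vec_isom T l j f)"
  unfolding markov_rep_def
proof (rule ae_class_eqI)
  show "AE x in M. complex_of_real (markov_weight T l j x) * rep_fun (ae_class M f) (shift x)
      = vec_isom T l j f x"
    using AE_shift[OF rep_fun_AE[OF assms]] by eventually_elim (simp add: vec_isom_def)
qed

lemma hadjoint_markov_rep:
  assumes j: "j < N" and g: "g \<in> square_integrable_funs M"
  shows "hadjoint (L2 M) (markov_rep T l M j) (ae_class M g) = ae_class M (vec_adj T l j g)"
proof (rule complex_hilbert_space.hadjoint_eqI[OF L2_hilbert])
  fix F assume "F \<in> carrier (L2 M)"
  then obtain f where f: "f \<in> square_integrable_funs M" and F: "F = ae_class M f"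
    by (rule L2_carrierE)
  show "hinner (L2 M) (markov_rep T l M j F) (ae_class M g)
      = hinner (L2 M) F (ae_class M (vec_adj T l j g))"
    using vec_isom_inner[OF j f g] f g j
    by (simp add: F markov_rep_class square_integrable_measurable L2_inner
        vec_isom_square_integrable vec_adj_square_integrable)
qed (use assms in \<open>auto intro: vec_adj_square_integrable\<close>)

lemma markov_rep_isometric:
  assumes j: "j < N"
  shows "isometric_operator (L2 M) (markov_rep T l M j)"
proof -
  let ?S = "markov_rep T l M j"
  have norm: "hnorm (L2 M) (?S F) = hnorm (L2 M) F" and closed: "?S F \<in> carrier (L2 M)"
    if "F \<in> carrier (L2 M)" for F
    using that j
    by (auto elim!: L2_carrierE intro!: L2_carrierI vec_isom_square_integrable simp: markov_rep_class square_integrable_measurable L2_norm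
        vec_isom_norm vec_isom_square_integrable)
  have add: "?S (F \<oplus>\<^bsub>L2 M\<^esub> G) = ?S F \<oplus>\<^bsub>L2 M\<^esub> ?S G"
    if FG: "F \<in> carrier (L2 M)" "G \<in> carrier (L2 M)" for F G
  proof -
    obtain f g where f: "f \<in> square_integrable_funs M" and F: "F = ae_class M f"
      and g: "g \<in> square_integrable_funs M" and G: "G = ae_class M g"
      using FG by (auto elim!: L2_carrierE)
    have "vec_isom T l j (\<lambda>x. f x + g x) = (\<lambda>x. vec_isom T l j f x + vec_isom T l j g x)"
      by (simp add: vec_isom_def distrib_left fun_eq_iff)
    then show ?thesis
      using f g j by (simp add: F G L2_add markov_rep_class square_integrable_measurable
          vec_isom_square_integrable)
  qed
  have smult: "?S (c \<odot>\<^bsub>L2 M\<^esub> F) = c \<odot>\<^bsub>L2 M\<^esub> ?S F" if F_in: "F \<in> carrier (L2 M)" for c F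
  proof -
    obtain f where f: "f \<in> square_integrable_funs M" and F: "F = ae_class M f"
      using F_in by (rule L2_carrierE)
    have "vec_isom T l j (\<lambda>x. c * f x) = (\<lambda>x. c * vec_isom T l j f x)"
      by (simp add: vec_isom_def fun_eq_iff)
    then show ?thesis
      using f j by (simp add: F L2_smult markov_rep_class square_integrable_measurable
          vec_isom_square_integrable)
  qed
  show ?thesis
    unfolding isometric_operator_def bounded_operator_def
    using norm closed add smult by (auto intro!: exI[of _ 1])
qed

lemma cuntz_rep_markov: "cuntz_rep N (L2 M) (markov_rep T l M)"
  unfolding cuntz_rep_def
proof (intro conjI allI impI ballI)
  show "complex_hilbert_space (L2 M)" by (rule L2_hilbert)
  show "isometric_operator (L2 M) (markov_rep T l M i)" if "i < N" for i
    using that by (rule markov_rep_isometric)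
  fix F assume "F \<in> carrier (L2 M)"
  then obtain f where f: "f \<in> square_integrable_funs M" and F: "F = ae_class M f"
    by (rule L2_carrierE)
  show "hadjoint (L2 M) (markov_rep T l M i) (markov_rep T l M j F) = (if i = j then F else \<zero>\<^bsub>L2 M\<^esub>)"
    if "i < N" "j < N" for i j
  proof -
    have "hadjoint (L2 M) (markov_rep T l M i) (markov_rep T l M j F)
        = ae_class M (vec_adj T l i (vec_isom T l j f))"
      using f that by (simp add: F markov_rep_class square_integrable_measurable
          hadjoint_markov_rep vec_isom_square_integrable)
    also have "\<dots> = ae_class M (\<lambda>x. if i = j then f x else 0)"
      using that by (intro ae_class_eqI AE_I2) (simp add: space_M vec_adj_isom)
    finally show ?thesis by (simp add: F L2_zero)
  qed
  interpret abelian_group "L2 M" by (rule L2_abelian_group)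
  have *: "vec_isom T l i (vec_adj T l i f) \<in> square_integrable_funs M" if "i < N" for i
    using that f by (intro vec_isom_square_integrable vec_adj_square_integrable)
  have "(\<Oplus>\<^bsub>L2 M\<^esub>i\<in>{..<N}. markov_rep T l M i (hadjoint (L2 M) (markov_rep T l M i) F))
      = (\<Oplus>\<^bsub>L2 M\<^esub>i\<in>{..<N}. ae_class M (vec_isom T l i (vec_adj T l i f)))"
    using f * by (intro finsum_cong')
      (auto simp: F hadjoint_markov_rep markov_rep_class vec_adj_measurable square_integrable_measurable)
  also have "\<dots> = ae_class M (\<lambda>x. \<Sum>i<N. vec_isom T l i (vec_adj T l i f) x)"
    using L2_finsum[of "{..<N}" "\<lambda>i. vec_isom T l i (vec_adj T l i f)" M] * by auto
  also have "\<dots> = F"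
    unfolding F using sum_isom_adj[of _ "\<lambda>_ _. 1" f]
    by (intro ae_class_eqI AE_I2) (simp add: space_M)
  finally show "(\<Oplus>\<^bsub>L2 M\<^esub>i\<in>{..<N}. markov_rep T l M i (hadjoint (L2 M) (markov_rep T l M i) F)) = F" .
qed

end

section \<open>Decay of the Hellinger affinity\<close>

lemma sqrt_mult_less_mean:
  fixes x y :: real
  assumes "x > 0" "y > 0" "x \<noteq> y"
  shows "sqrt (x * y) < (x + y) / 2"
proof -
  have "(sqrt x - sqrt y)\<^sup>2 > 0" using assms by simp
  then show ?thesis using assms by (simp add: power2_diff real_sqrt_mult)
qed

lemma sum_lists_length_Suc:
  "(\<Sum>I | set I \<subseteq> {..<N} \<and> length I = Suc n. f I)
     = (\<Sum>a<N. \<Sum>I | set I \<subseteq> {..<N} \<and> length I = n. f (a # I))"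
proof -
  let ?L = "{I. set I \<subseteq> {..<N} \<and> length I = n}"
  have "(\<Sum>I | set I \<subseteq> {..<N} \<and> length I = Suc n. f I) = (\<Sum>(I, a)\<in>?L \<times> {..<N}. f (a # I))"
    unfolding lists_length_Suc_eq
    by (subst sum.reindex) (auto simp: inj_on_def case_prod_unfold o_def)
  also have "\<dots> = (\<Sum>I\<in>?L. \<Sum>a<N. f (a # I))"
    by (simp add: sum.cartesian_product)
  also have "\<dots> = (\<Sum>a<N. \<Sum>I\<in>?L. f (a # I))"
    by (rule sum.swap)
  finally show ?thesis .
qed

text \<open>The measure of the cylinder of a nonempty word; the value at \<open>[]\<close> is a mere
  convention.\<close>

fun word_weight :: "(nat \<Rightarrow> nat \<Rightarrow> real) \<Rightarrow> (nat \<Rightarrow> real) \<Rightarrow> nat list \<Rightarrow> real" where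
  "word_weight T l [] = 1"
| "word_weight T l (i # I) = l i * path_weight T i I"

text \<open>The entry at \<open>i\<close> of the \<open>n\<close>-th power of the matrix
  \<open>R\<close> applied to the all-ones vector, that is, a row sum of that power.\<close>

fun affinity :: "nat \<Rightarrow> (nat \<Rightarrow> nat \<Rightarrow> real) \<Rightarrow> nat \<Rightarrow> nat \<Rightarrow> real" where
  "affinity N R 0 i = 1"
| "affinity N R (Suc n) i = (\<Sum>a<N. R i a * affinity N R n a)"

text \<open>The square root is multiplicative along a path, so splitting off the first letter
  reproduces the recursion of \<open>affinity\<close>.\<close>

lemma sum_sqrt_path_weight:
  "(\<Sum>I | set I \<subseteq> {..<N} \<and> length I = n. sqrt (path_weight T i I * path_weight T' i I))
     = affinity N (\<lambda>i a. sqrt (T i a * T' i a)) n i"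
proof (induction n arbitrary: i)
  case 0
  have "{I. set I \<subseteq> {..<N} \<and> length I = 0} = {[]}" by auto
  then show ?case by simp
next
  case (Suc n)
  have "sqrt (path_weight T i (a # I) * path_weight T' i (a # I))
      = sqrt (T i a * T' i a) * sqrt (path_weight T a I * path_weight T' a I)" for a I
    by (simp add: mult_ac flip: real_sqrt_mult)
  then show ?case
    unfolding sum_lists_length_Suc by (simp add: Suc flip: sum_distrib_left)
qed

text \<open>Two steps at a time, because in the application a row on which \<open>T\<close> and
  \<open>T'\<close> agree has sum exactly \<open>1\<close>, and only the square of the matrix
  contracts in every row.\<close>

lemma affinity_two_step:
  assumes R: "\<And>i a. i < N \<Longrightarrow> a < N \<Longrightarrow> R i a \<ge> 0"
    and c: "\<And>i. i < N \<Longrightarrow> affinity N R 2 i \<le> c" and "c \<ge> 0" "i < N"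
  shows "affinity N R (2 * m) i \<le> c ^ m"
  using \<open>i < N\<close>
proof (induction m arbitrary: i)
  case (Suc m)
  have "affinity N R (2 * Suc m) i = (\<Sum>a<N. R i a * (\<Sum>b<N. R a b * affinity N R (2 * m) b))"
    by simp
  also have "\<dots> \<le> (\<Sum>a<N. R i a * (\<Sum>b<N. R a b * c ^ m))"
    using Suc R by (intro sum_mono mult_left_mono) auto
  also have "\<dots> = affinity N R 2 i * c ^ m"
    by (simp add: numeral_2_eq_2 sum_distrib_right mult.assoc)
  also have "\<dots> \<le> c * c ^ m"
    using c[OF Suc.prems] \<open>c \<ge> 0\<close> by (intro mult_right_mono) auto
  finally show ?case by simp
qed simp

lemma (in markov) word_weight_nonneg: "set I \<subseteq> {..<N} \<Longrightarrow> word_weight T l I \<ge> 0"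
  by (cases I) (auto intro!: mult_nonneg_nonneg less_imp_le[OF l_pos] path_weight_nonneg)

lemma (in markov) measure_initial_event:
  "measure M {x \<in> words N. P (initial (Suc n) x)}
     = (\<Sum>I | set I \<subseteq> {..<N} \<and> length I = Suc n \<and> P I. word_weight T l I)"
proof -
  have "emeasure M {x \<in> words N. P (initial (Suc n) x)}
      = (\<Sum>I | set I \<subseteq> {..<N} \<and> length I = Suc n \<and> P I. ennreal (word_weight T l I))"
    unfolding emeasure_initial_event[OF sets_M]
    by (intro sum.cong refl) (auto simp: length_Suc_conv emeasure_cylinder)
  also have "\<dots> = ennreal (\<Sum>I | set I \<subseteq> {..<N} \<and> length I = Suc n \<and> P I. word_weight T l I)"
    by (rule sum_ennreal) (auto intro: word_weight_nonneg)
  moreover have "(\<Sum>I | set I \<subseteq> {..<N} \<and> length I = Suc n \<and> P I. word_weight T l I) \<ge> 0"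
    by (rule sum_nonneg) (auto intro: word_weight_nonneg)
  ultimately show ?thesis by (simp add: measure_def)
qed

section \<open>Comparing two Markov measures\<close>

locale markov_pair = A: markov N T l M + B: markov N T' l' M'
  for N T l M T' l' M'
begin

definition mean_trans :: "nat \<Rightarrow> nat \<Rightarrow> real" where
  "mean_trans i a = sqrt (T i a * T' i a)"

lemma mean_trans_pos: "i < N \<Longrightarrow> a < N \<Longrightarrow> mean_trans i a > 0"
  by (simp add: mean_trans_def A.T_pos B.T_pos)

lemma mean_trans_le: "i < N \<Longrightarrow> a < N \<Longrightarrow> mean_trans i a \<le> (T i a + T' i a) / 2"
  unfolding mean_trans_def by (rule arith_geo_mean_sqrt) (simp_all add: A.T_pos B.T_pos less_imp_le)

lemma mean_row_sum: "i < N \<Longrightarrow> (\<Sum>a<N. (T i a + T' i a) / 2) = 1"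
  by (simp add: A.T_sum B.T_sum sum.distrib flip: sum_divide_distrib)

lemma mean_trans_row_sum_le: "i < N \<Longrightarrow> (\<Sum>a<N. mean_trans i a) \<le> 1"
  using sum_mono[of "{..<N}" "mean_trans i" "\<lambda>a. (T i a + T' i a) / 2"] mean_trans_le mean_row_sum by auto

lemma affinity_exponential_decay:
  assumes "\<exists>i<N. \<exists>j<N. T i j \<noteq> T' i j"
  obtains c where "0 \<le> c" "c < 1" "\<And>m i. i < N \<Longrightarrow> affinity N mean_trans (2 * m) i \<le> c ^ m"
proof -
  obtain k j where k: "k < N" "j < N" "T k j \<noteq> T' k j" using assms by blast
  \<comment> \<open>The inequality of the means is strict at the entry \<open>(k, j)\<close>, where
    the matrices differ.\<close>
  have "(\<Sum>a<N. mean_trans k a) < (\<Sum>a<N. (T k a + T' k a) / 2)"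
  proof (rule sum_strict_mono_ex1)
    show "\<exists>a\<in>{..<N}. mean_trans k a < (T k a + T' k a) / 2"
      using k sqrt_mult_less_mean[OF A.T_pos B.T_pos, of k j k j]
      by (intro bexI[of _ j]) (auto simp: mean_trans_def)
  qed (use k mean_trans_le in auto)
  then have row_k: "(\<Sum>a<N. mean_trans k a) < 1" using k by (simp add: mean_row_sum)
  have lt1: "affinity N mean_trans 2 i < 1" if i: "i < N" for i
  proof -
    have "affinity N mean_trans 2 i = (\<Sum>a<N. mean_trans i a * (\<Sum>b<N. mean_trans a b))" by (simp add: numeral_2_eq_2)
    \<comment> \<open>From every \<open>i\<close> the deficient row \<open>k\<close> is reached in
      one step with positive weight, so its loss enters every row sum of the square.\<close>
    also have "\<dots> < (\<Sum>a<N. mean_trans i a)"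
    proof (rule sum_strict_mono_ex1)
      show "\<exists>a\<in>{..<N}. mean_trans i a * (\<Sum>b<N. mean_trans a b) < mean_trans i a"
        using k i row_k mean_trans_pos[of i k] by (intro bexI[of _ k]) (auto simp: mult_less_cancel_left2)
      show "\<forall>a\<in>{..<N}. mean_trans i a * (\<Sum>b<N. mean_trans a b) \<le> mean_trans i a"
        using mean_trans_pos[OF i] mean_trans_row_sum_le by (auto intro!: mult_left_le less_imp_le[OF mean_trans_pos[OF i]])
    qed simp
    also have "\<dots> \<le> 1" using i by (rule mean_trans_row_sum_le)
    finally show ?thesis .
  qed
  \<comment> \<open>There are finitely many letters, so the maximum is a uniform bound that stays
    below \<open>1\<close>.\<close>
  define c where "c = Max (affinity N mean_trans 2 ` {..<N})"
  have ne: "affinity N mean_trans 2 ` {..<N} \<noteq> {}" using k by auto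
  have c_ge: "affinity N mean_trans 2 i \<le> c" if "i < N" for i
    using that by (simp add: c_def)
  have "c < 1" using ne lt1 by (simp add: c_def)
  have "0 \<le> affinity N mean_trans 2 k"
    using k by (auto simp: numeral_2_eq_2 intro!: sum_nonneg mult_nonneg_nonneg less_imp_le[OF mean_trans_pos])
  with c_ge[OF k(1)] have "0 \<le> c" by simp
  show ?thesis
    by (rule that[OF \<open>0 \<le> c\<close> \<open>c < 1\<close>])
      (use c_ge \<open>0 \<le> c\<close> in \<open>auto intro!: affinity_two_step less_imp_le[OF mean_trans_pos]\<close>)
qed

text \<open>The minimum of the two weights of a word is at most their geometric mean.\<close>

lemma
  fixes n :: nat
  defines "H \<equiv> (\<Sum>i<N. sqrt (l i * l' i) * affinity N mean_trans n i)"
  shows measure_less_likely: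
      "measure M {x \<in> words N. word_weight T l (initial (Suc n) x) \<le> word_weight T' l' (initial (Suc n) x)} \<le> H"
    and measure_less_likely':
      "measure M' {x \<in> words N. \<not> word_weight T l (initial (Suc n) x) \<le> word_weight T' l' (initial (Suc n) x)} \<le> H"
proof -
  let ?L = "{I. set I \<subseteq> {..<N} \<and> length I = Suc n}"
  let ?w = "word_weight T l" and ?w' = "word_weight T' l'"
  have H: "(\<Sum>I\<in>?L. sqrt (?w I * ?w' I)) = H"
  proof -
    have "sqrt (?w (i # I) * ?w' (i # I)) = sqrt (l i * l' i) * sqrt (path_weight T i I * path_weight T' i I)"
      for i I by (simp add: mult_ac flip: real_sqrt_mult)
    then show ?thesis
      unfolding sum_lists_length_Suc H_def
      by (simp add: sum_sqrt_path_weight mean_trans_def [abs_def] flip: sum_distrib_left)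
  qed
  \<comment> \<open>The smaller number is \<open>sqrt (x * x)\<close>, and the root is
    monotone.\<close>
  have le_sqrt: "x \<le> sqrt (x * y)" if "0 \<le> x" "x \<le> y" for x y :: real
    using that real_sqrt_le_mono[of "x * x" "x * y"] by (simp add: mult_left_mono)
  have "(\<Sum>I | set I \<subseteq> {..<N} \<and> length I = Suc n \<and> ?w I \<le> ?w' I. ?w I)
      \<le> (\<Sum>I | set I \<subseteq> {..<N} \<and> length I = Suc n \<and> ?w I \<le> ?w' I. sqrt (?w I * ?w' I))"
    by (intro sum_mono) (auto intro!: le_sqrt A.word_weight_nonneg)
  also have "\<dots> \<le> (\<Sum>I\<in>?L. sqrt (?w I * ?w' I))"
    by (intro sum_mono2 finite_lists_length_eq)
      (auto intro!: mult_nonneg_nonneg A.word_weight_nonneg B.word_weight_nonneg)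
  finally show "measure M {x \<in> words N. ?w (initial (Suc n) x) \<le> ?w' (initial (Suc n) x)} \<le> H"
    by (simp add: A.measure_initial_event[of "\<lambda>I. ?w I \<le> ?w' I"] H)
  have "(\<Sum>I | set I \<subseteq> {..<N} \<and> length I = Suc n \<and> \<not> ?w I \<le> ?w' I. ?w' I)
      \<le> (\<Sum>I | set I \<subseteq> {..<N} \<and> length I = Suc n \<and> \<not> ?w I \<le> ?w' I. sqrt (?w I * ?w' I))"
    by (intro sum_mono, subst mult.commute) (auto intro!: le_sqrt B.word_weight_nonneg)
  also have "\<dots> \<le> (\<Sum>I\<in>?L. sqrt (?w I * ?w' I))"
    by (intro sum_mono2 finite_lists_length_eq)
      (auto intro!: mult_nonneg_nonneg A.word_weight_nonneg B.word_weight_nonneg)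
  finally show "measure M' {x \<in> words N. \<not> ?w (initial (Suc n) x) \<le> ?w' (initial (Suc n) x)} \<le> H"
    by (simp only: B.measure_initial_event[of "\<lambda>I. \<not> ?w I \<le> ?w' I"] H)
qed

text \<open>Prefixes of length \<open>2m + 1\<close> consist of one initial letter and
  \<open>2m\<close> transitions, which matches the two-step decay; Borel-Cantelli is then applied
  once under each measure.\<close>

lemma separating_events:
  assumes "\<exists>i<N. \<exists>j<N. T i j \<noteq> T' i j"
  obtains P where
    "AE x in M. \<forall>\<^sub>F m in sequentially. \<not> P (initial (Suc (2 * m)) x)"
    "AE x in M'. \<forall>\<^sub>F m in sequentially. P (initial (Suc (2 * m)) x)"
proof -
  obtain c where c: "0 \<le> c" "c < 1" "\<And>m i. i < N \<Longrightarrow> affinity N mean_trans (2 * m) i \<le> c ^ m"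
    using affinity_exponential_decay[OF assms] by metis
  define P where "P I \<longleftrightarrow> word_weight T l I \<le> word_weight T' l' I" for I
  \<comment> \<open>The contribution of the initial letter, independent of \<open>m\<close>.\<close>
  define K where "K = (\<Sum>i<N. sqrt (l i * l' i))"
  have H: "(\<Sum>i<N. sqrt (l i * l' i) * affinity N mean_trans (2 * m) i) \<le> K * c ^ m" for m
    unfolding K_def sum_distrib_right using c(3) A.l_pos B.l_pos
    by (intro sum_mono mult_left_mono) (auto simp: less_imp_le)
  have sumK: "summable (\<lambda>m. K * c ^ m)"
    using c by (intro summable_mult summable_geometric) auto
  have "summable (\<lambda>m. measure M {x \<in> words N. P (initial (Suc (2 * m)) x)})"
    by (rule summable_comparison_test'[OF sumK])
      (use order_trans[OF measure_less_likely H] in \<open>auto simp: P_def\<close>)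
  then have "AE x in M. \<forall>\<^sub>F m in sequentially. x \<in> space M - {x \<in> words N. P (initial (Suc (2 * m)) x)}"
    by (intro borel_cantelli_AE1 initial_event_sets[OF A.sets_M])
      (simp_all add: A.emeasure_finite less_top[symmetric])
  then have 1: "AE x in M. \<forall>\<^sub>F m in sequentially. \<not> P (initial (Suc (2 * m)) x)"
    by (auto simp: A.space_M elim!: eventually_mono)
  have "summable (\<lambda>m. measure M' {x \<in> words N. \<not> P (initial (Suc (2 * m)) x)})"
    by (rule summable_comparison_test'[OF sumK])
      (use order_trans[OF measure_less_likely' H] in \<open>auto simp: P_def\<close>)
  then have "AE x in M'. \<forall>\<^sub>F m in sequentially. x \<in> space M' - {x \<in> words N. \<not> P (initial (Suc (2 * m)) x)}"
    by (intro borel_cantelli_AE1 initial_event_sets[OF B.sets_M])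
      (simp_all add: B.emeasure_finite less_top[symmetric])
  then have 2: "AE x in M'. \<forall>\<^sub>F m in sequentially. P (initial (Suc (2 * m)) x)"
    by (auto simp: B.space_M elim!: eventually_mono)
  from 1 2 show ?thesis by (rule that)
qed

lemma mutually_singularI:
  assumes 1: "AE x in M. \<forall>\<^sub>F m in sequentially. \<not> P (initial (k m) x)"
    and 2: "AE x in M'. \<forall>\<^sub>F m in sequentially. P (initial (k m) x)"
  shows "mutually_singular M M'"
proof -
  \<comment> \<open>The words lying in infinitely many of the events: null for \<open>M\<close>,
    with null complement for \<open>M'\<close>.\<close>
  define Z where "Z = (\<Inter>n. \<Union>m\<in>{n..}. {x \<in> words N. P (initial (k m) x)})"
  have ev: "{x \<in> words N. P (initial n x)} \<in> sets M" for n
    by (rule initial_event_sets[OF A.sets_M])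
  have Z: "Z \<in> sets M"
    unfolding Z_def by (intro sets.countable_INT' image_subsetI sets.countable_UN'' ev) simp_all
  have Z': "Z \<in> sets M'" using Z by (simp only: A.sets_M B.sets_M)
  have "AE x in M. x \<notin> Z"
    using 1
  proof eventually_elim
    case (elim x)
    then obtain n0 where "\<And>m. m \<ge> n0 \<Longrightarrow> \<not> P (initial (k m) x)"
      unfolding eventually_sequentially by blast
    then show ?case unfolding Z_def by blast
  qed
  then have null: "emeasure M Z = 0"
    using AE_iff_null_sets[OF Z] by (simp add: null_setsD1)
  have "AE x in M'. x \<notin> space M' - Z"
    using 2
  proof eventually_elim
    case (elim x)
    then obtain n0 where "\<And>m. m \<ge> n0 \<Longrightarrow> P (initial (k m) x)"
      unfolding eventually_sequentially by blast
    then have "\<exists>m\<ge>n. P (initial (k m) x)" for n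
      by (intro exI[of _ "max n n0"]) simp
    then show ?case unfolding Z_def B.space_M by blast
  qed
  then have null': "emeasure M' (space M' - Z) = 0"
    using AE_iff_null_sets[of "space M' - Z" M'] Z' by (simp add: null_setsD1)
  show ?thesis
    unfolding mutually_singular_def using Z Z' null null' by blast
qed

section \<open>Intertwiners\<close>

lemma intertwiner_sum:
  assumes W: "bounded_operator (L2 M) (L2 M') W" and "finite A"
    and f: "\<And>i. i \<in> A \<Longrightarrow> f i \<in> square_integrable_funs M"
    and f': "\<And>i. i \<in> A \<Longrightarrow> f' i \<in> square_integrable_funs M'"
    and eq: "\<And>i. i \<in> A \<Longrightarrow> W (ae_class M (f i)) = ae_class M' (f' i)"
  shows "W (ae_class M (\<lambda>x. \<Sum>i\<in>A. f i x)) = ae_class M' (\<lambda>x. \<Sum>i\<in>A. f' i x)"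
  using \<open>finite A\<close> f f' eq
proof (induction A)
  case empty
  have carr: "ae_class M (\<lambda>x. 0) \<in> carrier (L2 M)" by auto
  then have "W (ae_class M (\<lambda>x. 0)) \<in> carrier (L2 M')"
    using W by (auto simp: bounded_operator_def)
  then obtain g where g: "g \<in> square_integrable_funs M'" "W (ae_class M (\<lambda>x. 0)) = ae_class M' g"
    by (rule L2_carrierE)
  \<comment> \<open>Homogeneity with the scalar \<open>0\<close> forces \<open>W\<close> to send
    zero to zero.\<close>
  have "W (0 \<odot>\<^bsub>L2 M\<^esub> ae_class M (\<lambda>x. 0)) = 0 \<odot>\<^bsub>L2 M'\<^esub> W (ae_class M (\<lambda>x. 0))"
    using W carr unfolding bounded_operator_def by blast
  then show ?case using g by (simp add: L2_smult)
next
  case (insert a A)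
  have sum: "(\<lambda>x. \<Sum>i\<in>A. f i x) \<in> square_integrable_funs M"
    "(\<lambda>x. \<Sum>i\<in>A. f' i x) \<in> square_integrable_funs M'"
    using L2_finsum[of A f M] L2_finsum[of A f' M'] insert by auto
  have "W (ae_class M (f a) \<oplus>\<^bsub>L2 M\<^esub> ae_class M (\<lambda>x. \<Sum>i\<in>A. f i x))
      = W (ae_class M (f a)) \<oplus>\<^bsub>L2 M'\<^esub> W (ae_class M (\<lambda>x. \<Sum>i\<in>A. f i x))"
    using W sum insert.prems unfolding bounded_operator_def by blast
  then show ?case using insert sum by (simp add: L2_add)
qed

text \<open>Multiplication by the indicator equals the sum over \<open>i\<close> of the adjoint of
  \<open>S_i\<close>, then multiplication by an indicator for the remaining \<open>n\<close>
  letters, then \<open>S_i\<close>. Since \<open>W\<close> passes through all three, induction on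
  the prefix length works; \<open>P\<close>, \<open>f\<close> and \<open>f'\<close> vary because
  each step replaces them.\<close>

lemma intertwiner_mult:
  assumes W: "bounded_operator (L2 M) (L2 M') W"
    and int: "intertwines N (L2 M) (markov_rep T l M) (L2 M') (markov_rep T' l' M') W"
    and f: "f \<in> square_integrable_funs M" and f': "f' \<in> square_integrable_funs M'"
    and eq: "W (ae_class M f) = ae_class M' f'"
  shows "W (ae_class M (\<lambda>x. of_bool (P (initial n x)) * f x))
    = ae_class M' (\<lambda>x. of_bool (P (initial n x)) * f' x)"
  using f f' eq
proof (induction n arbitrary: P f f')
  case 0
  show ?case
  proof (cases "P []")
    case True
    then show ?thesis using 0 by simp
  next
    case False
    \<comment> \<open>The indicator is constantly zero; the empty sum gives that \<open>W\<close>
      preserves zero.\<close>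
    then show ?thesis using intertwiner_sum[OF W, of "{}"] by simp
  qed
next
  case (Suc n)
  define g where "g i y = of_bool (P (i # initial n y)) * vec_adj T l i f y" for i y
  define g' where "g' i y = of_bool (P (i # initial n y)) * vec_adj T' l' i f' y" for i y
  have g: "g i \<in> square_integrable_funs M" if "i < N" for i
    unfolding g_def [abs_def]
    using A.square_integrable_mult_of_bool[OF A.vec_adj_square_integrable[OF that Suc.prems(1)]] .
  have g': "g' i \<in> square_integrable_funs M'" if "i < N" for i
    unfolding g'_def [abs_def]
    using B.square_integrable_mult_of_bool[OF B.vec_adj_square_integrable[OF that Suc.prems(2)]] .
  have W_g: "W (ae_class M (vec_isom T l i (g i))) = ae_class M' (vec_isom T' l' i (g' i))"
    if i: "i < N" for i
  proof -
    have adj: "W (hadjoint (L2 M) (markov_rep T l M i) (ae_class M f))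
        = hadjoint (L2 M') (markov_rep T' l' M' i) (W (ae_class M f))"
      using int i L2_carrierI[OF Suc.prems(1)] unfolding intertwines_def by blast
    have "W (ae_class M (vec_adj T l i f)) = ae_class M' (vec_adj T' l' i f')"
      using adj Suc.prems i by (simp add: A.hadjoint_markov_rep B.hadjoint_markov_rep)
    from Suc.IH[OF A.vec_adj_square_integrable[OF i Suc.prems(1)]
        B.vec_adj_square_integrable[OF i Suc.prems(2)] this, of "\<lambda>I. P (i # I)"]
    have "W (ae_class M (g i)) = ae_class M' (g' i)"
      unfolding g_def [abs_def] g'_def [abs_def] .
    moreover have "W (markov_rep T l M i (ae_class M (g i))) = markov_rep T' l' M' i (W (ae_class M (g i)))"
      using int i L2_carrierI[OF g[OF i]] unfolding intertwines_def by blast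
    ultimately show ?thesis
      using g[OF i] g'[OF i]
      by (simp add: A.markov_rep_class B.markov_rep_class square_integrable_measurable)
  qed
  have "ae_class M (\<lambda>x. of_bool (P (initial (Suc n) x)) * f x)
      = ae_class M (\<lambda>x. \<Sum>i<N. vec_isom T l i (g i) x)"
    unfolding g_def [abs_def]
    by (intro ae_class_eqI AE_I2) (simp add: A.space_M A.sum_isom_adj initial_Suc)
  moreover have "ae_class M' (\<lambda>x. of_bool (P (initial (Suc n) x)) * f' x)
      = ae_class M' (\<lambda>x. \<Sum>i<N. vec_isom T' l' i (g' i) x)"
    unfolding g'_def [abs_def]
    by (intro ae_class_eqI AE_I2) (simp add: B.space_M B.sum_isom_adj initial_Suc)
  moreover have "W (ae_class M (\<lambda>x. \<Sum>i<N. vec_isom T l i (g i) x))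
      = ae_class M' (\<lambda>x. \<Sum>i<N. vec_isom T' l' i (g' i) x)"
    using W_g g g'
    by (intro intertwiner_sum[OF W])
      (auto intro: A.vec_isom_square_integrable B.vec_isom_square_integrable)
  ultimately show ?case by simp
qed

lemma intertwiner_zero:
  assumes 1: "AE x in M. \<forall>\<^sub>F m in sequentially. \<not> P (initial (k m) x)"
    and 2: "AE x in M'. \<forall>\<^sub>F m in sequentially. P (initial (k m) x)"
    and W: "bounded_operator (L2 M) (L2 M') W"
    and int: "intertwines N (L2 M) (markov_rep T l M) (L2 M') (markov_rep T' l' M') W"
    and F: "F \<in> carrier (L2 M)"
  shows "W F = \<zero>\<^bsub>L2 M'\<^esub>"
proof -
  obtain f where f: "f \<in> square_integrable_funs M" and F_eq: "F = ae_class M f"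
    using F by (rule L2_carrierE)
  have "W F \<in> carrier (L2 M')" using W F by (auto simp: bounded_operator_def)
  then obtain f' where f': "f' \<in> square_integrable_funs M'" and WF: "W F = ae_class M' f'"
    by (rule L2_carrierE)
  obtain C where C: "\<And>G. G \<in> carrier (L2 M) \<Longrightarrow> hnorm (L2 M') (W G) \<le> C * hnorm (L2 M) G"
    using W unfolding bounded_operator_def by blast
  define u where "u m x = of_bool (P (initial (k m) x)) * f x" for m x
  define u' where "u' m x = of_bool (P (initial (k m) x)) * f' x" for m x
  have u: "u m \<in> square_integrable_funs M" for m
    unfolding u_def [abs_def] by (rule A.square_integrable_mult_of_bool[OF f])
  have u': "u' m \<in> square_integrable_funs M'" for m
    unfolding u'_def [abs_def] by (rule B.square_integrable_mult_of_bool[OF f'])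
  note [measurable] = u[THEN square_integrable_measurable] u'[THEN square_integrable_measurable]
    f[THEN square_integrable_measurable] f'[THEN square_integrable_measurable]
  have "W (ae_class M (u m)) = ae_class M' (u' m)" for m
    unfolding u_def [abs_def] u'_def [abs_def]
    by (rule intertwiner_mult[OF W int f f']) (simp add: WF flip: F_eq)
  then have le: "sqrt (\<integral>x. (cmod (u' m x))\<^sup>2 \<partial>M') \<le> C * sqrt (\<integral>x. (cmod (u m x))\<^sup>2 \<partial>M)" for m
    using C[OF L2_carrierI[OF u[of m]]] by (simp add: L2_norm u u')
  \<comment> \<open>The indicator is eventually zero at \<open>M\<close>-almost every word, and
    \<open>|f|^2\<close> dominates.\<close>
  have "(\<lambda>m. \<integral>x. (cmod (u m x))\<^sup>2 \<partial>M) \<longlonglongrightarrow> (\<integral>x. 0 \<partial>M)"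
  proof (rule integral_dominated_convergence[where w="\<lambda>x. (cmod (f x))\<^sup>2"])
    show "AE x in M. (\<lambda>m. (cmod (u m x))\<^sup>2) \<longlonglongrightarrow> 0"
      using 1 by eventually_elim (auto simp: u_def intro!: tendsto_eventually elim!: eventually_mono)
    show "AE x in M. norm ((cmod (u m x))\<^sup>2) \<le> (cmod (f x))\<^sup>2" for m
      by (rule AE_I2) (simp add: u_def)
  qed (simp_all add: square_integrable_cmod[OF f])
  then have lim: "(\<lambda>m. C * sqrt (\<integral>x. (cmod (u m x))\<^sup>2 \<partial>M)) \<longlonglongrightarrow> C * sqrt 0"
    by (intro tendsto_intros) simp
  \<comment> \<open>Under \<open>M'\<close> the indicator is eventually one instead, so the whole
    norm of \<open>W F\<close> survives in the limit.\<close>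
  have "(\<lambda>m. \<integral>x. (cmod (u' m x))\<^sup>2 \<partial>M') \<longlonglongrightarrow> (\<integral>x. (cmod (f' x))\<^sup>2 \<partial>M')"
  proof (rule integral_dominated_convergence[where w="\<lambda>x. (cmod (f' x))\<^sup>2"])
    show "AE x in M'. (\<lambda>m. (cmod (u' m x))\<^sup>2) \<longlonglongrightarrow> (cmod (f' x))\<^sup>2"
      using 2 by eventually_elim (auto simp: u'_def intro!: tendsto_eventually elim!: eventually_mono)
    show "AE x in M'. norm ((cmod (u' m x))\<^sup>2) \<le> (cmod (f' x))\<^sup>2" for m
      by (rule AE_I2) (simp add: u'_def)
  qed (simp_all add: square_integrable_cmod[OF f'])
  then have lim': "(\<lambda>m. sqrt (\<integral>x. (cmod (u' m x))\<^sup>2 \<partial>M')) \<longlonglongrightarrow> sqrt (\<integral>x. (cmod (f' x))\<^sup>2 \<partial>M')"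
    by (intro tendsto_intros)
  have "sqrt (\<integral>x. (cmod (f' x))\<^sup>2 \<partial>M') \<le> C * sqrt 0"
    by (rule LIMSEQ_le[OF lim' lim]) (use le in auto)
  then have "(\<integral>x. (cmod (f' x))\<^sup>2 \<partial>M') = 0"
    by (simp add: order_antisym)
  then have "AE x in M'. f' x = 0"
    using integral_nonneg_eq_0_iff_AE[OF square_integrable_cmod[OF f']] by simp
  then show ?thesis
    unfolding WF L2_zero by (rule ae_class_eqI)
qed

end

theorem theorem3p9:
  fixes N :: nat
    and T T' :: "nat \<Rightarrow> nat \<Rightarrow> real"
    and l l' :: "nat \<Rightarrow> real"
    and \<mu> \<mu>' :: "(nat \<Rightarrow> nat) measure"
  assumes "N \<ge> 2"
    and "markov_measure N T l \<mu>"
    and "markov_measure N T' l' \<mu>'"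
    and "\<exists>i<N. \<exists>j<N. T i j \<noteq> T' i j"
  shows "disjoint_reps N (L2 \<mu>) (markov_rep T l \<mu>) (L2 \<mu>') (markov_rep T' l' \<mu>')
       \<and> mutually_singular \<mu> \<mu>'"
proof -
  interpret markov_pair N T l \<mu> T' l' \<mu>'
    by (intro markov_pair.intro markov.intro assms)
  obtain P where sep:
    "AE x in \<mu>. \<forall>\<^sub>F m in sequentially. \<not> P (initial (Suc (2 * m)) x)"
    "AE x in \<mu>'. \<forall>\<^sub>F m in sequentially. P (initial (Suc (2 * m)) x)"
    using separating_events[OF assms(4)] .
  show ?thesis
    unfolding disjoint_reps_def
    using A.cuntz_rep_markov B.cuntz_rep_markov intertwiner_zero[OF sep] mutually_singularI[OF sep]
    by blast
qed

end
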